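(* Let $\mathcal{T}$ be a singular triangulation of a connected, closed, oriented 3-dimensional pseudo-manifold $P$, with set of tetrahedra $T$ and set of edges $E$. Let $\mathcal{L}$ be the set of longitudes on the vertex links, let $G\colon\mathbb{H}^T\to\mathbb{C}^E$ be the log-curvature map and $H_{\mathcal{L}}\colon\mathbb{H}^T\to\mathbb{C}^{\mathcal{L}}$ the boundary map. Then for all $u\in\mathbb{C}^E$ such that $G^{-1}(u)\neq\emptyset$, the restriction $$H_{\mathcal{L}}|_{G^{-1}(u)}\colon G^{-1}(u)\longrightarrow\mathbb{C}^{\mathcal{L}}$$ is a local diffeomorphism onto its image.
   Context: Triangulation. Let $\widetilde{\Delta}$ be a finite disjoint union of oriented Euclidean 3-simplices and $\Phi$ a family of orientation-reversing affine isomorphisms pairing the 2-dimensional faces of $\widetilde\Delta$, closed under inverses and such that every face is the domain of a unique element of $\Phi$. The quotient $P=\widetilde\Delta/\Phi$, assumed connected, is a closed orientable 3-dimensional pseudo-manifold with quotient map $p\colon\widetilde\Delta\to P$, and $\mathcal{T}=(\widetilde\Delta,\Phi,p)$ is a (singular) triangulation of $P$. $T$ is the set of 3-simplices of $\widetilde\Delta$; $E$ and $V=\{v_i\}$ are the sets of edges and vertices of $P$, i.e. the equivalence classes of 1- and 0-simplices of $\widetilde\Delta$. For $v\in V$, $\mathrm{Lk}(v)$ denotes the vertex link, a closed orientable surface, oriented by the orientation of $P$, with triangulation induced from $\mathcal{T}$ (its triangles are normal triangles cutting off corners of the tetrahedra; each vertex of such a triangle in $\sigma$ lies on an edge of $\sigma$).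 The genus of $\mathrm{Lk}(v_i)$ is $g_i\ge0$. Quadrilateral types. A quadrilateral type $q$ in a 3-simplex $\sigma$ is a pair $q=\{e_0,e_1\}$ of opposite edges of $\sigma$ (we write $q<\sigma$); each $\sigma$ has three. The orientation of $\sigma$ gives a cyclic order $q\to q'\to q''\to q$ on them: if the vertices of $\sigma$ are labelled $0,1,2,3$ compatibly with the orientation, it is (type containing edge $01$) $\to$ (type containing $02$) $\to$ (type containing $03$) $\to$ (type containing $01$). $\Box$ is the set of all quadrilateral types of all $\sigma\in T$. For $q\in\Box$, $e\in E$, $i(q,e)\in\{0,1,2\}$ is the number of the two edges in $q$ that are mapped by $p$ to $e$. Log-curvature map. Let $\mathbb{H}\subset\mathbb{C}$ be the open upper half plane and $Z=\{z\in\mathbb{H}^{\Box} : z(q')=\tfrac{1}{1-z(q)}\ \text{for all } q\in\Box\}$. Fixing a preferred quadrilateral type $q_\sigma<\sigma$ for each $\sigma\in T$, $Z$ is identified with $\mathbb{H}^T$ via $z\mapsto (z(q_\sigma))_{\sigma\in T}$. The log-curvature map $G\colon Z=\mathbb{H}^T\to\mathbb{C}^E$ is $G(z)(e)=\sum_{q\in\Box} i(q,e)\log z(q)$, where $\log$ is the standard branch on $\mathbb{C}\setminus(-\infty,0]$. It is known that each non-empty level set $G^{-1}(u)$ is a smooth complex manifold of dimension $\sum_i g_i=|\mathcal{L}|$ (with $\mathcal{L}$ as below). Normal curves and log holonomy. A closed normal curve on $\mathrm{Lk}(v)$ avoids the vertices of the induced triangulation, is transverse to its edges, and meets each triangle in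 arcs (segments) joining distinct sides. For an oriented closed normal curve $\alpha$, let $S_\alpha$ be its set of oriented segments. A segment $s$ in a triangle $t$ contained in a tetrahedron $\sigma$ isolates one vertex $x_s$ of $t$ from the other two; $q_s<\sigma$ is the quadrilateral type containing the edge of $\sigma$ through $x_s$. Set $\eta(s)=+1$ if $x_s$ lies on the right side of $s$ and $\eta(s)=-1$ if on the left side, as viewed from the vertex $v$ (the cusp). Put $\eta(q,s)=\eta(s)$ if $q=q_s$ and $0$ otherwise, and $\eta(q,\alpha)=\sum_{s\in S_\alpha}\eta(q,s)$. The log holonomy of $\alpha$ is $h_\alpha\colon Z\to\mathbb{C}$, $h_\alpha(z)=\sum_{q\in\Box}\eta(q,\alpha)\log z(q)$. Boundary map. For each $v_i\in V$ choose a canonical generating set $\mathcal{L}_i\cup\mathcal{M}_i$ of the fundamental group of $\mathrm{Lk}(v_i)$, with longitudes $\mathcal{L}_i=\{\lambda^i_1,\dots,\lambda^i_{g_i}\}$ and meridians $\mathcal{M}_i=\{\mu^i_1,\dots,\mu^i_{g_i}\}$, all oriented closed normal curves, such that the algebraic intersection number satisfies $\iota(\lambda^i_j,\mu^i_j)=1$ for all $j$ and is $0$ for all other pairs of elements of $\mathcal{L}_i\cup\mathcal{M}_i$ (up to the antisymmetry of $\iota$). Let $\mathcal{L}=\bigcup_i\mathcal{L}_i$. The boundary map $H_{\mathcal{L}}\colon Z=\mathbb{H}^T\to\mathbb{C}^{\mathcal{L}}$ is $H_{\mathcal{L}}(z)(\lambda)=h_\lambda(z)$ for $\lambda\in\mathcal{L}$.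 *)

theory Defs
  imports "HOL-Analysis.Analysis" "HOL-Combinatorics.Permutations"
begin

section \<open>Singular triangulations\<close>

text \<open>The vertices of every 3-simplex are labelled compatibly with its orientation, and the set of
  3-simplices is the finite type of simplices. The face of a simplex opposite the vertex \<open>i\<close> is
  called face \<open>i\<close>.\<close>

datatype lab = L0 | L1 | L2 | L3

instance lab :: finite
proof
  have "(UNIV :: lab set) = {L0, L1, L2, L3}"
    using lab.exhaust by auto
  then show "finite (UNIV :: lab set)"
    by (metis finite.emptyI finite_insert)
qed

text \<open>An affine isomorphism between two faces is determined by what it does to the vertices. If face
  \<open>i\<close> of \<open>\<sigma>\<close> is glued to a face of \<open>\<tau>\<close>, then \<open>gl \<sigma> i = (\<tau>, \<pi>)\<close>, where the vertex \<open>j \<noteq> i\<close> of the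
  face goes to the vertex \<open>\<pi> j\<close> of \<open>\<tau>\<close>. The map of vertices is extended to a permutation of all four
  labels by letting \<open>\<pi> i\<close> be the vertex of \<open>\<tau>\<close> opposite the target face. For the orientations
  induced on the faces, the isomorphism reverses orientation iff this permutation is odd.\<close>

type_synonym 't gluing = "'t \<Rightarrow> lab \<Rightarrow> 't \<times> (lab \<Rightarrow> lab)"

definition nbr :: "'t gluing \<Rightarrow> 't \<Rightarrow> lab \<Rightarrow> 't" where
  "nbr gl \<sigma> i = fst (gl \<sigma> i)"

definition gmap :: "'t gluing \<Rightarrow> 't \<Rightarrow> lab \<Rightarrow> lab \<Rightarrow> lab" where
  "gmap gl \<sigma> i = snd (gl \<sigma> i)"

text \<open>The last condition says that the quotient is connected. It is generated by face pairings, so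
  this is connectedness of the graph of adjacent 3-simplices. No face is paired with itself.\<close>

definition singular_triangulation :: "('t::finite) gluing \<Rightarrow> bool" where
  "singular_triangulation gl \<longleftrightarrow>
     (\<forall>\<sigma> i. gmap gl \<sigma> i permutes UNIV \<and> \<not> evenperm (gmap gl \<sigma> i) \<and>
            gl (nbr gl \<sigma> i) (gmap gl \<sigma> i i) = (\<sigma>, inv (gmap gl \<sigma> i)) \<and>
            (nbr gl \<sigma> i, gmap gl \<sigma> i i) \<noteq> (\<sigma>, i)) \<and>
     (\<forall>\<sigma> \<tau>. (\<sigma>, \<tau>) \<in> {(\<rho>, nbr gl \<rho> i) | \<rho> i. True}\<^sup>*)"

text \<open>The relations below are symmetric because the family of gluings is closed under inverses.\<close>

definition vertices :: "('t::finite) gluing \<Rightarrow> ('t \<times> lab) set set" where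
  "vertices gl = UNIV // {((\<sigma>, j), (nbr gl \<sigma> i, gmap gl \<sigma> i j)) | \<sigma> i j. j \<noteq> i}\<^sup>*"

definition edges :: "('t::finite) gluing \<Rightarrow> ('t \<times> lab set) set set" where
  "edges gl = {(\<sigma>, x). card x = 2} //
     {((\<sigma>, x), (nbr gl \<sigma> i, gmap gl \<sigma> i ` x)) | \<sigma> i x. card x = 2 \<and> i \<notin> x}\<^sup>*"


section \<open>Quadrilateral types, shape parameters and log-curvature\<close>

definition quad :: "lab set \<Rightarrow> lab set set" where
  "quad x = {x, - x}"

definition quad_types :: "('t \<times> lab set set) set" where
  "quad_types = {(\<sigma>, quad x) | \<sigma> x. card x = 2}"

definition quad_next :: "'t \<times> lab set set \<Rightarrow> 't \<times> lab set set" where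
  "quad_next q = (fst q,
     if {L0, L1} \<in> snd q then quad {L0, L2}
     else if {L0, L2} \<in> snd q then quad {L0, L3}
     else quad {L0, L1})"

definition quad_index :: "'t \<times> lab set set \<Rightarrow> ('t \<times> lab set) set \<Rightarrow> nat" where
  "quad_index q e = card {x \<in> snd q. (fst q, x) \<in> e}"

definition shape_space :: "('t \<times> lab set set \<Rightarrow> complex) set" where
  "shape_space = {z \<in> quad_types \<rightarrow>\<^sub>E {c. 0 < Im c}. \<forall>q\<in>quad_types. z (quad_next q) = 1 / (1 - z q)}"

definition half_space :: "(complex ^ 't) set" where
  "half_space = {w. \<forall>\<sigma>. 0 < Im (w $ \<sigma>)}"

text \<open>Identification of \<open>shape_space\<close> with \<open>half_space\<close> by the preferred quadrilateral types
  \<open>pref \<sigma>\<close>, and its inverse.\<close>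

definition coords ::
  "('t \<Rightarrow> lab set set) \<Rightarrow> ('t \<times> lab set set \<Rightarrow> complex) \<Rightarrow> complex ^ 't" where
  "coords pref z = (\<chi> \<sigma>. z (\<sigma>, pref \<sigma>))"

definition shapes ::
  "('t \<Rightarrow> lab set set) \<Rightarrow> complex ^ 't \<Rightarrow> 't \<times> lab set set \<Rightarrow> complex" where
  "shapes pref = inv_into shape_space (coords pref)"

definition log_curvature ::
  "('t::finite) gluing \<Rightarrow> ('t \<times> lab set set \<Rightarrow> complex) \<Rightarrow> ('t \<times> lab set) set \<Rightarrow> complex" where
  "log_curvature gl z = (\<lambda>e\<in>edges gl. \<Sum>q\<in>quad_types. of_nat (quad_index q e) * Ln (z q))"

definition level_set ::
  "('t::finite) gluing \<Rightarrow> ('t \<Rightarrow> lab set set) \<Rightarrow> (('t \<times> lab set) set \<Rightarrow> complex) \<Rightarrow> (complex ^ 't) set"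
where
  "level_set gl pref u = {w \<in> half_space. log_curvature gl (shapes pref w) = u}"


section \<open>Vertex links\<close>

text \<open>The normal triangle cutting off the vertex \<open>i\<close> of \<open>\<sigma>\<close> is the pair \<open>(\<sigma>, i)\<close>, and the
  triangles of the link of \<open>v \<in> vertices gl\<close> are the elements of \<open>v\<close>. For \<open>j \<noteq> i\<close> it has a vertex
  on the edge \<open>{i, j}\<close> of \<open>\<sigma>\<close>, and the opposite side lies in face \<open>j\<close> of \<open>\<sigma>\<close>. Both are
  denoted by \<open>(\<sigma>, i, j)\<close>.\<close>

type_synonym 't side = "'t \<times> lab \<times> lab"

fun triangle_of :: "'t side \<Rightarrow> 't \<times> lab" where
  "triangle_of (\<sigma>, i, j) = (\<sigma>, i)"

text \<open>The same side, as a side of the triangle beyond it.\<close>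

fun across :: "'t gluing \<Rightarrow> 't side \<Rightarrow> 't side" where
  "across gl (\<sigma>, i, j) = (nbr gl \<sigma> j, gmap gl \<sigma> j i, gmap gl \<sigma> j j)"

definition triangle_sides :: "('t \<times> lab) set \<Rightarrow> 't side set" where
  "triangle_sides v = {(\<sigma>, i, j). (\<sigma>, i) \<in> v \<and> j \<noteq> i}"

definition link_edges :: "'t gluing \<Rightarrow> ('t \<times> lab) set \<Rightarrow> 't side set set" where
  "link_edges gl v = triangle_sides v // {(f, f'). f' = f \<or> f' = across gl f}"

definition link_vertices :: "'t gluing \<Rightarrow> ('t \<times> lab) set \<Rightarrow> ('t \<times> lab \<times> lab) set set" where
  "link_vertices gl v = {(\<sigma>, i, k). (\<sigma>, i) \<in> v \<and> k \<noteq> i} //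
     {((\<sigma>, i, k), (nbr gl \<sigma> j, gmap gl \<sigma> j i, gmap gl \<sigma> j k)) | \<sigma> i j k. distinct [i, j, k]}\<^sup>*"

definition link_euler :: "'t gluing \<Rightarrow> ('t \<times> lab) set \<Rightarrow> int" where
  "link_euler gl v = int (card (link_vertices gl v)) - int (card (link_edges gl v)) + int (card v)"

text \<open>The link is a closed connected orientable surface, so this determines its genus \<open>g\<close>.\<close>

definition link_genus :: "'t gluing \<Rightarrow> ('t \<times> lab) set \<Rightarrow> nat \<Rightarrow> bool" where
  "link_genus gl v g \<longleftrightarrow> link_euler gl v = 2 - 2 * int g"

text \<open>Viewed from the vertex \<open>i\<close>, the three other vertices appear in the counterclockwise cyclic
  order \<open>a\<close>, \<open>b\<close>, \<open>c\<close> iff \<open>i, a, b, c\<close> is an even permutation of the labels. This orients the link.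
  The corresponding vertices of the triangle at \<open>i\<close> and their opposite sides both have this cyclic
  order.\<close>

definition ccw :: "lab \<Rightarrow> lab \<Rightarrow> lab \<Rightarrow> bool" where
  "ccw i a b \<longleftrightarrow> (\<exists>p. p permutes UNIV \<and> evenperm p \<and> p L0 = i \<and> p L1 = a \<and> p L2 = b)"


section \<open>Normal curves and log holonomy\<close>

text \<open>The segment \<open>(\<sigma>, i, a, b)\<close> runs in the triangle \<open>(\<sigma>, i)\<close> from side \<open>a\<close> to side \<open>b\<close>. A closed
  normal curve is the cyclic sequence of its segments, so the same kind of segment may occur
  more than once.\<close>

type_synonym 't segment = "'t \<times> lab \<times> lab \<times> lab"
type_synonym 't curve = "'t segment list"

fun seg_entry :: "'t segment \<Rightarrow> 't side" where
  "seg_entry (\<sigma>, i, a, b) = (\<sigma>, i, a)"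

fun seg_exit :: "'t segment \<Rightarrow> 't side" where
  "seg_exit (\<sigma>, i, a, b) = (\<sigma>, i, b)"

definition closed_normal_curve :: "'t gluing \<Rightarrow> ('t \<times> lab) set \<Rightarrow> 't curve \<Rightarrow> bool" where
  "closed_normal_curve gl v \<alpha> \<longleftrightarrow> \<alpha> \<noteq> [] \<and>
     (\<forall>(\<sigma>, i, a, b)\<in>set \<alpha>. (\<sigma>, i) \<in> v \<and> distinct [i, a, b]) \<and>
     (\<forall>n<length \<alpha>. seg_entry (\<alpha> ! (Suc n mod length \<alpha>)) = across gl (seg_exit (\<alpha> ! n)))"

text \<open>The sides \<open>a\<close> and \<open>b\<close> meet in the vertex isolated by the segment, which lies on the edge
  \<open>{i, k}\<close> of \<open>\<sigma>\<close> for the fourth label \<open>k\<close>, that is, on \<open>- {a, b}\<close>. Going from side \<open>a\<close> to side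
  \<open>b\<close>, it is on the right iff \<open>a\<close>, \<open>b\<close>, \<open>k\<close> is the counterclockwise order.\<close>

fun seg_quad :: "'t segment \<Rightarrow> 't \<times> lab set set" where
  "seg_quad (\<sigma>, i, a, b) = (\<sigma>, quad (- {a, b}))"

fun seg_eta :: "'t segment \<Rightarrow> int" where
  "seg_eta (\<sigma>, i, a, b) = (if ccw i a b then 1 else - 1)"

definition curve_eta :: "'t \<times> lab set set \<Rightarrow> 't curve \<Rightarrow> int" where
  "curve_eta q \<alpha> = (\<Sum>s\<leftarrow>\<alpha>. if q = seg_quad s then seg_eta s else 0)"

definition log_holonomy ::
  "('t::finite) curve \<Rightarrow> ('t \<times> lab set set \<Rightarrow> complex) \<Rightarrow> complex" where
  "log_holonomy \<alpha> z = (\<Sum>q\<in>quad_types. of_int (curve_eta q \<alpha>) * Ln (z q))"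


section \<open>Algebraic intersection numbers\<close>

text \<open>To put \<open>\<alpha>\<close> and \<open>\<beta>\<close> in general position, let both cross the sides of the triangles at their
  midpoints and then push \<open>\<alpha>\<close> slightly to its left. After this, the midpoints of the two sides
  that a segment of \<open>\<alpha>\<close> joins are on its right, and the midpoint of the third side is on its left iff
  the isolated vertex is on its right. A segment of \<open>\<beta>\<close> in the same triangle counts \<open>1\<close> if it
  crosses the segment of \<open>\<alpha>\<close> from right to left, and \<open>-1\<close> if from left to right.\<close>

fun left_of :: "'t segment \<Rightarrow> lab \<Rightarrow> bool" where
  "left_of (\<sigma>, i, a, b) c \<longleftrightarrow> c \<notin> {a, b} \<and> ccw i a b"

fun seg_intersection :: "'t segment \<Rightarrow> 't segment \<Rightarrow> int" where
  "seg_intersection s (\<sigma>, i, a, b) =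
     (if triangle_of (seg_entry s) = (\<sigma>, i)
      then of_bool (left_of s b) - of_bool (left_of s a) else 0)"

definition intersection_number :: "'t curve \<Rightarrow> 't curve \<Rightarrow> int" where
  "intersection_number \<alpha> \<beta> = (\<Sum>s\<leftarrow>\<alpha>. \<Sum>s'\<leftarrow>\<beta>. seg_intersection s s')"


section \<open>Fundamental groups of links\<close>

text \<open>We use the cell structure dual to the triangulation of the link. A path is given by the
  successive sides of triangles through which it leaves these triangles. Homotopy is generated by
  backtracking and by the boundaries of the dual 2-cells, which are the normal curves with their
  isolated vertices all on the left.\<close>

fun link_path :: "'t gluing \<Rightarrow> 't \<times> lab \<Rightarrow> 't side list \<Rightarrow> 't \<times> lab \<Rightarrow> bool" where
  "link_path gl b [] c \<longleftrightarrow> b = c"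
| "link_path gl b (f # p) c \<longleftrightarrow>
     triangle_of f = b \<and> f \<in> triangle_sides UNIV \<and> link_path gl (triangle_of (across gl f)) p c"

definition inverse_path :: "'t gluing \<Rightarrow> 't side list \<Rightarrow> 't side list" where
  "inverse_path gl p = rev (map (across gl) p)"

definition null_loop :: "'t gluing \<Rightarrow> 't side list \<Rightarrow> bool" where
  "null_loop gl r \<longleftrightarrow> (\<exists>f. r = [f, across gl f]) \<or>
     (\<exists>\<alpha>. closed_normal_curve gl UNIV \<alpha> \<and> (\<forall>s\<in>set \<alpha>. seg_eta s = - 1) \<and> r = map seg_exit \<alpha>)"

definition homotopic_link_paths ::
  "'t gluing \<Rightarrow> 't \<times> lab \<Rightarrow> 't \<times> lab \<Rightarrow> 't side list \<Rightarrow> 't side list \<Rightarrow> bool" where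
  "homotopic_link_paths gl b c = equivclp (\<lambda>w w'. \<exists>p r q. null_loop gl r \<and>
     w = p @ q \<and> w' = p @ r @ q \<and> link_path gl b w c \<and> link_path gl b w' c)"

text \<open>The elements of \<open>C\<close> are free loops. They are joined to the base triangle \<open>b\<close> by paths
  \<open>tail \<alpha>\<close>.\<close>

definition generates_fundamental_group ::
  "'t gluing \<Rightarrow> ('t \<times> lab) set \<Rightarrow> 't curve set \<Rightarrow> bool" where
  "generates_fundamental_group gl v C \<longleftrightarrow>
     (\<exists>b\<in>v. \<exists>tail.
        (\<forall>\<alpha>\<in>C. link_path gl b (tail \<alpha>) (triangle_of (seg_entry (hd \<alpha>)))) \<and>
        (let gens = (\<lambda>\<alpha>. tail \<alpha> @ map seg_exit \<alpha> @ inverse_path gl (tail \<alpha>)) ` C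
         in \<forall>w. link_path gl b w b \<longrightarrow>
              (\<exists>ws. set ws \<subseteq> gens \<union> inverse_path gl ` gens \<and>
                    homotopic_link_paths gl b b w (concat ws))))"


section \<open>Longitudes, meridians and the boundary map\<close>

definition canonical_generators ::
  "'t gluing \<Rightarrow> ('t \<times> lab) set \<Rightarrow> 'l set \<Rightarrow> ('l \<Rightarrow> 't curve) \<Rightarrow> ('l \<Rightarrow> 't curve) \<Rightarrow> bool" where
  "canonical_generators gl v J lon mer \<longleftrightarrow>
     link_genus gl v (card J) \<and>
     (\<forall>j\<in>J. closed_normal_curve gl v (lon j) \<and> closed_normal_curve gl v (mer j)) \<and>
     generates_fundamental_group gl v (lon ` J \<union> mer ` J) \<and>
     (\<forall>j\<in>J. \<forall>k\<in>J. intersection_number (lon j) (mer k) = of_bool (j = k) \<and>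
                  intersection_number (mer k) (lon j) = - of_bool (j = k) \<and>
                  intersection_number (lon j) (lon k) = 0 \<and>
                  intersection_number (mer j) (mer k) = 0)"

text \<open>The set \<open>I\<close> indexes all longitudes and meridians, and \<open>vtx j\<close> is the vertex on whose link
  \<open>lon j\<close> and \<open>mer j\<close> lie. The index set is a subset of a finite type rather than a type since it is
  empty if all links are spheres.\<close>

definition canonical_curve_system ::
  "('t::finite) gluing \<Rightarrow> 'l set \<Rightarrow> ('l \<Rightarrow> ('t \<times> lab) set) \<Rightarrow> ('l \<Rightarrow> 't curve) \<Rightarrow> ('l \<Rightarrow> 't curve) \<Rightarrow> bool"
where
  "canonical_curve_system gl I vtx lon mer \<longleftrightarrow>
     vtx ` I \<subseteq> vertices gl \<and>
     (\<forall>v\<in>vertices gl. canonical_generators gl v {j \<in> I. vtx j = v} lon mer)"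

text \<open>The complex vector space of functions on \<open>I\<close>, as a subspace.\<close>

definition coord_space :: "'l set \<Rightarrow> (complex ^ 'l) set" where
  "coord_space I = {w. \<forall>j. j \<notin> I \<longrightarrow> w $ j = 0}"

definition boundary_map ::
  "'l set \<Rightarrow> ('l \<Rightarrow> ('t::finite) curve) \<Rightarrow> ('t \<times> lab set set \<Rightarrow> complex) \<Rightarrow> complex ^ 'l" where
  "boundary_map I lon z = (\<chi> j. if j \<in> I then log_holonomy (lon j) z else 0)"


section \<open>Smooth maps and local diffeomorphisms\<close>

primrec C_k_on ::
  "nat \<Rightarrow> 'a::euclidean_space set \<Rightarrow> ('a \<Rightarrow> 'b::euclidean_space) \<Rightarrow> bool" where
  "C_k_on 0 S f \<longleftrightarrow> continuous_on S f"
| "C_k_on (Suc k) S f \<longleftrightarrow> (\<forall>x\<in>S. f differentiable (at x)) \<and>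
     (\<forall>d. C_k_on k S (\<lambda>x. frechet_derivative f (at x) d))"

text \<open>A map on an arbitrary subset of a Euclidean space is smooth if it extends locally to smooth
  maps on open sets. On embedded submanifolds this is the usual notion.\<close>

definition smooth_map_on ::
  "'a::euclidean_space set \<Rightarrow> ('a \<Rightarrow> 'b::euclidean_space) \<Rightarrow> bool" where
  "smooth_map_on X f \<longleftrightarrow>
     (\<forall>x\<in>X. \<exists>U F. open U \<and> x \<in> U \<and> (\<forall>k. C_k_on k U F) \<and> (\<forall>y\<in>X \<inter> U. F y = f y))"

definition diffeomorphism_on ::
  "'a::euclidean_space set \<Rightarrow> 'b::euclidean_space set \<Rightarrow> ('a \<Rightarrow> 'b) \<Rightarrow> bool" where
  "diffeomorphism_on X Y f \<longleftrightarrow>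
     bij_betw f X Y \<and> smooth_map_on X f \<and> smooth_map_on Y (inv_into X f)"

definition local_diffeomorphism_on ::
  "'a::euclidean_space set \<Rightarrow> 'b::euclidean_space set \<Rightarrow> ('a \<Rightarrow> 'b) \<Rightarrow> bool" where
  "local_diffeomorphism_on X N f \<longleftrightarrow>
     (\<forall>x\<in>X. \<exists>U. x \<in> U \<and> openin (top_of_set X) U \<and> openin (top_of_set N) (f ` U) \<and>
                diffeomorphism_on U (f ` U) f)"

end

theory Submission imports Defs begin

text \<open>Let every edge and every closed normal curve act on logarithms of shapes by an integer row
  indexed by the quadrilateral types, modulo rows constant on the quadrilateral types of a simplex. Following Neumann
  and Zagier, these rows live in a symplectic space of dimension \<open>2 |T|\<close> in which edges are
  orthogonal to edges and to curves, and two curves pair to twice their intersection number. The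
  relations among the edge rows are the functions \<open>g(v) + g(w)\<close> on edges \<open>vw\<close>, so by Euler
  characteristics the edge rows have rank \<open>|E| - |V| = |T| - |I|\<close>. Pairing with meridians shows that
  the longitudes are independent modulo the edges, so edges and longitudes span a Lagrangian subspace.

  The derivative of the map given by a basis of that subspace is injective at every point of
  \<open>half_space\<close>: a real Lagrangian annihilates only vectors on which the Hermitian form of the
  symplectic form vanishes, and this form is definite on tangent vectors because the shapes have
  positive imaginary part. The inverse function theorem gives local coordinates in which the level
  set is a coordinate plane with the log holonomies of the longitudes as coordinates.\<close>

section \<open>Orientations of labels\<close>

text \<open>Rows matter only modulo constants on a simplex because its three logarithms sum to i pi,
  so a constant row changes a sum of logarithms only by an additive constant. It is essential that
  the coefficients are real: a complex vector annihilated by all rows then has its real and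
  imaginary parts annihilated separately, and this turns the symplectic form into a Hermitian one.
  The meridians never enter the Lagrangian subspace; they are only test vectors that detect the
  longitudes. The dimension |T| comes out of a squeeze. Isotropy bounds it from above, so the counts
  of simplices have to bound it only from below, and each incidence count on the links can be a
  one-sided inequality.\<close>

lemma UNIV_lab: "(UNIV :: lab set) = {L0, L1, L2, L3}"
  using lab.exhaust by auto

text \<open>For \<open>i \<noteq> j\<close>, the label \<open>k = third i j\<close> is the one for which \<open>i, j, k\<close> and the remaining label
  form an even permutation.\<close>

fun third :: "lab \<Rightarrow> lab \<Rightarrow> lab" where
  "third L0 L1 = L2" | "third L0 L2 = L3" | "third L0 L3 = L1"
| "third L1 L0 = L3" | "third L1 L2 = L0" | "third L1 L3 = L2"
| "third L2 L0 = L1" | "third L2 L1 = L3" | "third L2 L3 = L0"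
| "third L3 L0 = L2" | "third L3 L1 = L0" | "third L3 L2 = L1"
| "third i j = i"

abbreviation fourth :: "lab \<Rightarrow> lab \<Rightarrow> lab" where
  "fourth i j \<equiv> third i (third i j)"

lemma third_fourth_distinct: "i \<noteq> j \<Longrightarrow> distinct [i, j, third i j, fourth i j]"
  by (cases i; cases j) simp_all

lemma third_neq:
  assumes "i \<noteq> j"
  shows "third i j \<noteq> i" "third i j \<noteq> j" "fourth i j \<noteq> i" "fourth i j \<noteq> j" "fourth i j \<noteq> third i j"
    "i \<noteq> third i j" "j \<noteq> third i j" "i \<noteq> fourth i j" "j \<noteq> fourth i j" "third i j \<noteq> fourth i j"
  using third_fourth_distinct[OF assms] by auto

lemma third_fourth: "i \<noteq> j \<Longrightarrow> third i (fourth i j) = j"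
  by (cases i; cases j) simp_all

lemma third_transpose:
  "i \<noteq> j \<Longrightarrow> a \<noteq> b \<Longrightarrow>
    Transposition.transpose a b (third i j) = fourth (Transposition.transpose a b i) (Transposition.transpose a b j)"
  by (cases i; cases j; simp; cases a; cases b; simp add: Transposition.transpose_def)

text \<open>By \<open>third_transpose\<close>, each transposition interchanges the roles of
  \<open>third\<close> and \<open>fourth\<close>, so the parity of their number decides which of the
  two is hit.\<close>

lemma permutes_third:
  assumes "p permutes (UNIV :: lab set)" "i \<noteq> j"
  shows "p (third i j) = (if evenperm p then third (p i) (p j) else fourth (p i) (p j))"
proof -
  have "\<forall>i j. i \<noteq> j \<longrightarrow>
      p (third i j) = (if evenperm p then third (p i) (p j) else fourth (p i) (p j))"
    using assms(1) finite[of "UNIV :: lab set"]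
  proof (induction rule: permutes_induct)
    case id
    then show ?case by simp
  next
    case (swap a b p)
    have perm: "permutation p" "permutation (Transposition.transpose a b)"
      using swap(4) finite[of "UNIV :: lab set"] permutation_permutes by (blast, simp add: permutation_swap_id)
    have inj: "inj p"
      using swap(4) permutes_inj by blast
    show ?case
    proof (intro allI impI)
      fix i j :: lab assume ij: "i \<noteq> j"
      then have pij: "p i \<noteq> p j" using inj by (simp add: inj_eq)
      have d: "p i \<noteq> third (p i) (p j)" "p i \<noteq> fourth (p i) (p j)" "third (p i) (fourth (p i) (p j)) = p j"
        using third_fourth_distinct[OF pij] third_fourth[OF pij] by auto
      have e: "evenperm (Transposition.transpose a b \<circ> p) \<longleftrightarrow> \<not> evenperm p"
        using evenperm_comp[OF perm(2,1)] \<open>a \<noteq> b\<close> by (simp add: evenperm_swap)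
      have f: "third (Transposition.transpose a b (p i)) (Transposition.transpose a b (p j)) = Transposition.transpose a b (fourth (p i) (p j))"
      proof -
        let ?t = "Transposition.transpose a b"
        have ne: "?t (p i) \<noteq> ?t (p j)" using pij by (metis transpose_involutory)
        have "?t (fourth (p i) (p j)) = fourth (?t (p i)) (?t (third (p i) (p j)))"
          by (rule third_transpose[OF d(1) \<open>a \<noteq> b\<close>])
        also have "\<dots> = fourth (?t (p i)) (fourth (?t (p i)) (?t (p j)))"
          by (simp add: third_transpose[OF pij \<open>a \<noteq> b\<close>])
        also have "\<dots> = third (?t (p i)) (?t (p j))"
          by (simp add: third_fourth[OF ne])
        finally show ?thesis by simp
      qed
      show "(Transposition.transpose a b \<circ> p) (third i j) = (if evenperm (Transposition.transpose a b \<circ> p)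
           then third ((Transposition.transpose a b \<circ> p) i) ((Transposition.transpose a b \<circ> p) j)
           else fourth ((Transposition.transpose a b \<circ> p) i) ((Transposition.transpose a b \<circ> p) j))"
        using swap(5) ij third_transpose[OF pij \<open>a \<noteq> b\<close>] f unfolding e by auto
    qed
  qed
  then show ?thesis using assms(2) by blast
qed

lemma ccw_iff: "ccw i a b \<longleftrightarrow> i \<noteq> a \<and> b = third i a"
proof
  assume "ccw i a b"
  then obtain p where p: "p permutes (UNIV :: lab set)" "evenperm p" "p L0 = i" "p L1 = a" "p L2 = b"
    unfolding ccw_def by blast
  have "i \<noteq> a" using permutes_inj[OF p(1)] p(3,4) by (metis inj_eq lab.distinct(1))
  then show "i \<noteq> a \<and> b = third i a"
    using permutes_third[OF p(1), of L0 L1] p by simp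
next
  assume ia: "i \<noteq> a \<and> b = third i a"
  \<comment> \<open>The first transposition brings \<open>L0\<close> to \<open>i\<close> and moves
    \<open>L1\<close> to \<open>x\<close>; the second brings \<open>x\<close> to \<open>a\<close>
    and fixes \<open>i\<close>, as \<open>i\<close> is neither \<open>x\<close> nor
    \<open>a\<close>.\<close>
  define x where "x = Transposition.transpose L0 i L1"
  define p where "p = Transposition.transpose x a \<circ> Transposition.transpose L0 i"
  have p: "p permutes (UNIV :: lab set)" "p L0 = i" "p L1 = a"
    using ia unfolding p_def x_def
    by (auto intro!: permutes_compose permutes_swap_id simp: Transposition.transpose_def)
  show "ccw i a b"
  proof (cases "evenperm p")
    case True
    then show ?thesis
      unfolding ccw_def using p ia permutes_third[OF p(1), of L0 L1]
      by (intro exI[of _ p]) simp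
  next
    case False
    \<comment> \<open>Exchanging \<open>L2\<close> and \<open>L3\<close> first corrects the parity
      and leaves the images of \<open>L0\<close> and \<open>L1\<close> alone.\<close>
    define p' where "p' = p \<circ> Transposition.transpose L2 L3"
    have perm: "permutation p" using p(1) permutation_permutes finite by blast
    have p': "p' permutes UNIV" "p' L0 = i" "p' L1 = a"
      using p unfolding p'_def by (auto intro!: permutes_compose permutes_swap_id simp: Transposition.transpose_def)
    moreover have "evenperm p'"
      using False evenperm_comp[OF perm permutation_swap_id, of L2 L3]
      by (simp add: p'_def evenperm_swap)
    ultimately show ?thesis
      unfolding ccw_def using ia permutes_third[OF p'(1), of L0 L1]
      by (intro exI[of _ p']) simp
  qed
qed

section \<open>Quadrilateral types of a simplex\<close>

lemma quad_uminus: "quad (- x) = quad x"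
  by (auto simp: quad_def)

lemma uminus_lab_pair:
  "- {L0, L1} = {L2, L3}" "- {L0, L2} = {L1, L3}" "- {L0, L3} = {L1, L2}"
  "- {L1, L2} = {L0, L3}" "- {L1, L3} = {L0, L2}" "- {L2, L3} = {L0, L1}"
  using UNIV_lab by auto

lemma quad_explicit:
  "quad {L0, L1} = {{L0, L1}, {L2, L3}}"
  "quad {L0, L2} = {{L0, L2}, {L1, L3}}"
  "quad {L0, L3} = {{L0, L3}, {L1, L2}}"
  by (simp_all add: quad_def uminus_lab_pair)

lemma quad_pairs:
  "quad {L2, L3} = quad {L0, L1}" "quad {L1, L3} = quad {L0, L2}" "quad {L1, L2} = quad {L0, L3}"
  "quad {L1, L0} = quad {L0, L1}" "quad {L2, L0} = quad {L0, L2}" "quad {L3, L0} = quad {L0, L3}"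
  "quad {L3, L2} = quad {L0, L1}" "quad {L3, L1} = quad {L0, L2}" "quad {L2, L1} = quad {L0, L3}"
  by (auto simp: quad_def uminus_lab_pair insert_commute)

lemma quad_distinct:
  "quad {L0, L1} \<noteq> quad {L0, L2}" "quad {L0, L1} \<noteq> quad {L0, L3}" "quad {L0, L2} \<noteq> quad {L0, L3}"
  "quad {L0, L2} \<noteq> quad {L0, L1}" "quad {L0, L3} \<noteq> quad {L0, L1}" "quad {L0, L3} \<noteq> quad {L0, L2}"
  by (auto simp: quad_explicit doubleton_eq_iff)

lemma card_2_labE:
  fixes x :: "lab set"
  assumes "card x = 2"
  obtains i j where "i \<noteq> j" "x = {i, j}"
  using assms that unfolding card_2_iff by blast

lemma quad_types_eq: "quad_types = UNIV \<times> {quad {L0, L1}, quad {L0, L2}, quad {L0, L3}}"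
proof -
  have "quad x \<in> {quad {L0, L1}, quad {L0, L2}, quad {L0, L3}}" if x: "card x = 2" for x
  proof -
    obtain i j where "i \<noteq> j" "x = {i, j}" using x by (rule card_2_labE)
    then show ?thesis by (cases i; cases j) (simp_all add: quad_pairs)
  qed
  moreover have "card {L0, L1} = 2" "card {L0, L2} = 2" "card {L0, L3} = 2" by simp_all
  ultimately show ?thesis
    unfolding quad_types_def by blast
qed

lemma sum_quad_types:
  fixes f :: "('t::finite) \<times> lab set set \<Rightarrow> 'a::comm_monoid_add"
  shows "(\<Sum>q\<in>quad_types. f q) =
    (\<Sum>\<sigma>\<in>UNIV. f (\<sigma>, quad {L0, L1}) + (f (\<sigma>, quad {L0, L2}) + f (\<sigma>, quad {L0, L3})))"
  unfolding quad_types_eq sum.cartesian_product'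
  by (simp add: quad_distinct)

section \<open>The symplectic form on rows\<close>

text \<open>The sum of \<open>A q * B q' - A q' * B q\<close> over all \<open>q\<close>, where \<open>q'\<close> is \<open>quad_next q\<close>.\<close>

definition omega :: "(('t::finite) \<times> lab set set \<Rightarrow> int) \<Rightarrow> ('t \<times> lab set set \<Rightarrow> int) \<Rightarrow> int" where
  "omega A B = (\<Sum>\<sigma>\<in>UNIV.
       A (\<sigma>, quad {L0, L1}) * B (\<sigma>, quad {L0, L2}) - A (\<sigma>, quad {L0, L2}) * B (\<sigma>, quad {L0, L1})
     + A (\<sigma>, quad {L0, L2}) * B (\<sigma>, quad {L0, L3}) - A (\<sigma>, quad {L0, L3}) * B (\<sigma>, quad {L0, L2})
     + A (\<sigma>, quad {L0, L3}) * B (\<sigma>, quad {L0, L1}) - A (\<sigma>, quad {L0, L1}) * B (\<sigma>, quad {L0, L3}))"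

lemma omega_sum_list_right:
  "omega A (\<lambda>q. \<Sum>s\<leftarrow>xs. B s q) = (\<Sum>s\<leftarrow>xs. omega A (B s))"
proof (induction xs)
  case Nil
  then show ?case by (simp add: omega_def)
next
  case (Cons s xs)
  have "omega A (\<lambda>q. B s q + (\<Sum>s\<leftarrow>xs. B s q)) = omega A (B s) + omega A (\<lambda>q. \<Sum>s\<leftarrow>xs. B s q)"
    unfolding omega_def sum.distrib[symmetric] by (rule sum.cong) (simp_all add: algebra_simps)
  then show ?case using Cons by simp
qed

section \<open>Rows of segments and telescoping along closed curves\<close>

definition seg_row :: "'t segment \<Rightarrow> 't \<times> lab set set \<Rightarrow> int" where
  "seg_row s q = (if q = seg_quad s then seg_eta s else 0)"

lemma curve_eta_eq: "curve_eta q \<alpha> = (\<Sum>s\<leftarrow>\<alpha>. seg_row s q)"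
  by (simp add: curve_eta_def seg_row_def)

fun normal_segment :: "'t segment \<Rightarrow> bool" where
  "normal_segment (\<sigma>, i, a, b) \<longleftrightarrow> distinct [i, a, b]"

text \<open>The triple also names the vertex of the triangle opposite to the side; that vertex lies
  on the edge \<open>{i, j}\<close>, whose quadrilateral type is evaluated.\<close>

fun side_row :: "('t \<times> lab set set \<Rightarrow> int) \<Rightarrow> 't side \<Rightarrow> int" where
  "side_row A (\<sigma>, i, j) = A (\<sigma>, quad {i, j})"

text \<open>A row supported on one type picks out the difference of \<open>A\<close> at the
  preceding and the following type. For a segment from side \<open>a\<close> to side
  \<open>b\<close> these are the types of \<open>{i, a}\<close> and \<open>{i, b}\<close>, and
  \<open>seg_eta\<close> corrects their order. Pairing with a segment is thus a discrete derivative
  along it.\<close>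

lemma omega_seg_row:
  assumes "normal_segment s"
  shows "omega A (seg_row s) = side_row A (seg_exit s) - side_row A (seg_entry s)"
proof -
  obtain \<sigma> i a b where s: "s = (\<sigma>, i, a, b)" by (metis prod_cases4)
  define t where "t = (\<lambda>\<tau>.
       A (\<tau>, quad {L0, L1}) * seg_row s (\<sigma>, quad {L0, L2}) - A (\<tau>, quad {L0, L2}) * seg_row s (\<sigma>, quad {L0, L1})
     + A (\<tau>, quad {L0, L2}) * seg_row s (\<sigma>, quad {L0, L3}) - A (\<tau>, quad {L0, L3}) * seg_row s (\<sigma>, quad {L0, L2})
     + A (\<tau>, quad {L0, L3}) * seg_row s (\<sigma>, quad {L0, L1}) - A (\<tau>, quad {L0, L1}) * seg_row s (\<sigma>, quad {L0, L3}))"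
  have "omega A (seg_row s) = (\<Sum>\<tau>\<in>UNIV. if \<tau> = \<sigma> then t \<tau> else 0)"
    unfolding omega_def t_def by (rule sum.cong) (auto simp: seg_row_def s)
  also have "\<dots> = t \<sigma>" by simp
  also have "\<dots> = A (\<sigma>, quad {i, b}) - A (\<sigma>, quad {i, a})"
    using assms unfolding s t_def seg_row_def
    by (cases i; cases a; cases b)
      (simp_all add: ccw_iff quad_pairs quad_distinct quad_uminus)
  finally show ?thesis by (simp add: s)
qed

lemma closed_normal_curve_segments:
  "closed_normal_curve gl v \<alpha> \<Longrightarrow> s \<in> set \<alpha> \<Longrightarrow> normal_segment s"
  by (cases s) (auto simp: closed_normal_curve_def)

lemma mset_rotate1_eq: "mset (rotate1 xs) = mset xs"
  by (cases xs) simp_all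

lemma map_entry_rotate1:
  assumes "closed_normal_curve gl v \<alpha>"
  shows "map seg_entry (rotate1 \<alpha>) = map (\<lambda>s. across gl (seg_exit s)) \<alpha>"
  using assms by (intro nth_equalityI) (auto simp: closed_normal_curve_def nth_rotate1)

lemma sum_list_entry_eq_exit:
  fixes f :: "'t side \<Rightarrow> int"
  assumes "closed_normal_curve gl v \<alpha>"
  shows "(\<Sum>s\<leftarrow>\<alpha>. f (seg_entry s)) = (\<Sum>s\<leftarrow>\<alpha>. f (across gl (seg_exit s)))"
proof -
  have "mset (map seg_entry \<alpha>) = mset (map (\<lambda>s. across gl (seg_exit s)) \<alpha>)"
    using map_entry_rotate1[OF assms] by (metis mset_map mset_rotate1_eq)
  then have "mset (map f (map seg_entry \<alpha>)) = mset (map f (map (\<lambda>s. across gl (seg_exit s)) \<alpha>))"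
    by (metis mset_map)
  then show ?thesis
    by (metis (no_types, lifting) list.map_comp comp_def map_eq_conv sum_mset_sum_list)
qed

definition side_invariant :: "'t gluing \<Rightarrow> ('t side \<Rightarrow> int) \<Rightarrow> bool" where
  "side_invariant gl \<Phi> \<longleftrightarrow> (\<forall>\<sigma> i j. i \<noteq> j \<longrightarrow> \<Phi> (across gl (\<sigma>, i, j)) = \<Phi> (\<sigma>, i, j))"

text \<open>Consecutive segments meet in glued sides, where the two values of \<open>\<Phi>\<close>
  agree, so the increments telescope around the closed curve.\<close>

lemma sum_list_side_invariant:
  assumes "closed_normal_curve gl v \<alpha>" "side_invariant gl \<Phi>"
  shows "(\<Sum>s\<leftarrow>\<alpha>. \<Phi> (seg_exit s) - \<Phi> (seg_entry s)) = 0"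
proof -
  have "\<Phi> (across gl (seg_exit s)) = \<Phi> (seg_exit s)" if "s \<in> set \<alpha>" for s
    using closed_normal_curve_segments[OF assms(1) that] assms(2)
    by (cases s) (auto simp: side_invariant_def)
  then have "(\<Sum>s\<leftarrow>\<alpha>. \<Phi> (seg_entry s)) = (\<Sum>s\<leftarrow>\<alpha>. \<Phi> (seg_exit s))"
    unfolding sum_list_entry_eq_exit[OF assms(1)] by (metis (no_types, lifting) map_eq_conv)
  then show ?thesis by (simp add: sum_list_subtractf)
qed

lemma omega_curve_eta:
  assumes "closed_normal_curve gl v \<beta>"
  shows "omega A (\<lambda>q. curve_eta q \<beta>) =
    (\<Sum>s\<leftarrow>\<beta>. side_row A (seg_exit s) - side_row A (seg_entry s))"
proof -
  have "omega A (\<lambda>q. curve_eta q \<beta>) = (\<Sum>s\<leftarrow>\<beta>. omega A (seg_row s))"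
    unfolding curve_eta_eq by (rule omega_sum_list_right)
  also have "\<dots> = (\<Sum>s\<leftarrow>\<beta>. side_row A (seg_exit s) - side_row A (seg_entry s))"
    using closed_normal_curve_segments[OF assms] by (intro arg_cong[of _ _ sum_list] map_cong) (auto simp: omega_seg_row)
  finally show ?thesis .
qed

section \<open>Gluings acting on labels and sides\<close>

lemma singular_triangulationD:
  assumes "singular_triangulation gl"
  shows "gmap gl \<sigma> i permutes UNIV" "\<not> evenperm (gmap gl \<sigma> i)"
    "gl (nbr gl \<sigma> i) (gmap gl \<sigma> i i) = (\<sigma>, inv (gmap gl \<sigma> i))"
    "(nbr gl \<sigma> i, gmap gl \<sigma> i i) \<noteq> (\<sigma>, i)"
  using assms unfolding singular_triangulation_def by blast+

lemma gmap_third: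
  assumes "singular_triangulation gl" "j \<noteq> k"
  shows "gmap gl \<sigma> i (third j k) = fourth (gmap gl \<sigma> i j) (gmap gl \<sigma> i k)"
  using permutes_third[OF singular_triangulationD(1)[OF assms(1)] assms(2)]
    singular_triangulationD(2)[OF assms(1)] by simp

lemma gmap_eq_iff:
  assumes "singular_triangulation gl"
  shows "gmap gl \<sigma> i j = gmap gl \<sigma> i k \<longleftrightarrow> j = k"
  using permutes_inj[OF singular_triangulationD(1)[OF assms]] by (simp add: inj_eq)

lemma gmap_fourth:
  assumes "singular_triangulation gl" "j \<noteq> k"
  shows "gmap gl \<sigma> i (fourth j k) = third (gmap gl \<sigma> i j) (gmap gl \<sigma> i k)"
proof -
  let ?p = "gmap gl \<sigma> i"
  have jk: "j \<noteq> third j k" using third_fourth_distinct[OF assms(2)] by auto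
  have p: "?p j \<noteq> ?p k" using assms by (simp add: gmap_eq_iff)
  have "?p (fourth j k) = third (?p j) (third (?p j) (?p (third j k)))"
    by (rule gmap_third[OF assms(1) jk])
  also have "\<dots> = third (?p j) (third (?p j) (fourth (?p j) (?p k)))"
    by (simp add: gmap_third[OF assms])
  also have "\<dots> = third (?p j) (?p k)"
    by (simp add: third_fourth[OF p])
  finally show ?thesis .
qed

lemma across_across:
  assumes "singular_triangulation gl"
  shows "across gl (across gl f) = f"
proof -
  obtain \<sigma> i j where f: "f = (\<sigma>, i, j)" by (metis prod_cases3)
  let ?p = "gmap gl \<sigma> j"
  have "nbr gl (nbr gl \<sigma> j) (?p j) = \<sigma>" "gmap gl (nbr gl \<sigma> j) (?p j) = inv ?p"
    using singular_triangulationD(3)[OF assms, of \<sigma> j] by (simp_all add: nbr_def gmap_def)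
  then show ?thesis
    using permutes_inverses(2)[OF singular_triangulationD(1)[OF assms]] by (simp add: f)
qed

lemma across_eq_iff:
  "singular_triangulation gl \<Longrightarrow> across gl f = g \<longleftrightarrow> f = across gl g"
  using across_across by metis

section \<open>Pairings with edge rows\<close>

definition edge_invariant :: "'t gluing \<Rightarrow> ('t \<times> lab set \<Rightarrow> 'a) \<Rightarrow> bool" where
  "edge_invariant gl f \<longleftrightarrow> (\<forall>\<sigma> i x. card x = 2 \<and> i \<notin> x \<longrightarrow> f (nbr gl \<sigma> i, gmap gl \<sigma> i ` x) = f (\<sigma>, x))"

text \<open>A weighted form of the incidence number: the indicator function of an edge class gives
  \<open>quad_index\<close>.\<close>

definition edge_row :: "('t \<times> lab set \<Rightarrow> int) \<Rightarrow> 't \<times> lab set set \<Rightarrow> int" where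
  "edge_row f q = (\<Sum>x\<in>snd q. f (fst q, x))"

lemma edge_row_quads:
  "edge_row f (\<sigma>, quad {L0, L1}) = f (\<sigma>, {L0, L1}) + f (\<sigma>, {L2, L3})"
  "edge_row f (\<sigma>, quad {L0, L2}) = f (\<sigma>, {L0, L2}) + f (\<sigma>, {L1, L3})"
  "edge_row f (\<sigma>, quad {L0, L3}) = f (\<sigma>, {L0, L3}) + f (\<sigma>, {L1, L2})"
  by (simp_all add: edge_row_def quad_explicit doubleton_eq_iff)

text \<open>Let \<open>k\<close>, \<open>l\<close> be the labels other than \<open>i\<close>,
  \<open>j\<close>. The edge row at the side \<open>(\<sigma>, i, j)\<close> is
  \<open>f{i,j} + f{k,l}\<close>, and \<open>\<Phi>\<close> differs from it by the sum of
  \<open>f\<close> over the three edges at \<open>i\<close>. That sum is the same for all sides of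
  the triangle, so both have equal increments along segments; but \<open>\<Phi>\<close> involves
  only edges of the face \<open>j\<close>, hence is invariant under gluing.\<close>

lemma omega_edge_curve:
  assumes "singular_triangulation gl" "edge_invariant gl f" "closed_normal_curve gl v \<alpha>"
  shows "omega (edge_row f) (\<lambda>q. curve_eta q \<alpha>) = 0"
proof -
  define \<Phi> where "\<Phi> = (\<lambda>(\<sigma>, i, j). f (\<sigma>, {third i j, fourth i j}) - f (\<sigma>, {i, third i j}) - f (\<sigma>, {i, fourth i j}))"
  have inv: "f (nbr gl \<sigma> j, {gmap gl \<sigma> j a, gmap gl \<sigma> j b}) = f (\<sigma>, {a, b})"
    if "a \<noteq> b" "a \<noteq> j" "b \<noteq> j" for \<sigma> j a b
    using assms(2)[unfolded edge_invariant_def, rule_format, of "{a, b}" j \<sigma>] that by simp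
  have "side_invariant gl \<Phi>"
    unfolding side_invariant_def
  proof (intro allI impI)
    fix \<sigma> and i j :: lab assume ij: "i \<noteq> j"
    show "\<Phi> (across gl (\<sigma>, i, j)) = \<Phi> (\<sigma>, i, j)"
      using ij third_neq[OF ij]
      by (simp add: \<Phi>_def gmap_fourth[OF assms(1), symmetric] third_fourth[OF ij] gmap_eq_iff[OF assms(1)] inv insert_commute)
  qed
  moreover have "side_row (edge_row f) (seg_exit s) - side_row (edge_row f) (seg_entry s) = \<Phi> (seg_exit s) - \<Phi> (seg_entry s)"
    if "s \<in> set \<alpha>" for s
  proof -
    obtain \<sigma> i a b where s: "s = (\<sigma>, i, a, b)" by (metis prod_cases4)
    show ?thesis
      using closed_normal_curve_segments[OF assms(3) that]
      unfolding s \<Phi>_def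
      by (cases i; cases a; cases b) (simp_all add: quad_pairs edge_row_quads insert_commute)
  qed
  ultimately show ?thesis
    unfolding omega_curve_eta[OF assms(3)]
    using sum_list_side_invariant[OF assms(3)] by (metis (no_types, lifting) map_eq_conv)
qed

text \<open>Two edges of a simplex with different quadrilateral types lie in a unique face, and the
  contributions of glued faces cancel because gluings reverse orientation.\<close>

lemma omega_edge_edge:
  assumes "singular_triangulation gl" "edge_invariant gl f" "edge_invariant gl g"
  shows "omega (edge_row f) (edge_row g) = 0"
proof -
  \<comment> \<open>The index \<open>(\<sigma>, a, j)\<close> stands for the two edges of face
    \<open>j\<close> that meet in \<open>c\<close>, taken in the cyclic order of the face. The
    twelve such pairs give all products of weights on adjacent edges of a simplex.\<close>
  define D where "D = (\<lambda>(\<sigma>, a, j). let b = third j a; c = fourth j a in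
     f (\<sigma>, {b, c}) * g (\<sigma>, {c, a}) - f (\<sigma>, {c, a}) * g (\<sigma>, {b, c}))"
  define S :: "'a side set" where "S = {(\<sigma>, a, j). a \<noteq> j}"
  have inv: "f (nbr gl \<sigma> j, {gmap gl \<sigma> j a, gmap gl \<sigma> j b}) = f (\<sigma>, {a, b})"
     "g (nbr gl \<sigma> j, {gmap gl \<sigma> j a, gmap gl \<sigma> j b}) = g (\<sigma>, {a, b})"
    if "a \<noteq> b" "a \<noteq> j" "b \<noteq> j" for \<sigma> j a b
    using assms(2,3)[unfolded edge_invariant_def, rule_format, of "{a, b}" j \<sigma>] that by auto
  have omega_D: "omega (edge_row f) (edge_row g) = sum D S"
  proof -
    have "S = UNIV \<times> {(L0,L1),(L0,L2),(L0,L3),(L1,L0),(L1,L2),(L1,L3),(L2,L0),(L2,L1),(L2,L3),(L3,L0),(L3,L1),(L3,L2)}"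
      (is "_ = _ \<times> ?P")
    proof -
      have "a \<noteq> j \<longleftrightarrow> (a, j) \<in> ?P" for a j by (cases a; cases j) simp_all
      then show ?thesis unfolding S_def by auto
    qed
    then have "sum D S = (\<Sum>\<sigma>\<in>UNIV. \<Sum>p\<in>?P. D (\<sigma>, p))"
      by (simp only: sum.cartesian_product')
    also have "\<dots> = omega (edge_row f) (edge_row g)"
      unfolding omega_def
    proof (rule sum.cong[OF refl])
      fix \<sigma> :: 'a
      have "(\<Sum>p\<in>?P. D (\<sigma>, p)) =
          D (\<sigma>,L0,L1) + D (\<sigma>,L0,L2) + D (\<sigma>,L0,L3) + D (\<sigma>,L1,L0) + D (\<sigma>,L1,L2) + D (\<sigma>,L1,L3)
        + D (\<sigma>,L2,L0) + D (\<sigma>,L2,L1) + D (\<sigma>,L2,L3) + D (\<sigma>,L3,L0) + D (\<sigma>,L3,L1) + D (\<sigma>,L3,L2)"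
        by simp
      also have "\<dots> =
          edge_row f (\<sigma>, quad {L0, L1}) * edge_row g (\<sigma>, quad {L0, L2})
        - edge_row f (\<sigma>, quad {L0, L2}) * edge_row g (\<sigma>, quad {L0, L1})
        + edge_row f (\<sigma>, quad {L0, L2}) * edge_row g (\<sigma>, quad {L0, L3})
        - edge_row f (\<sigma>, quad {L0, L3}) * edge_row g (\<sigma>, quad {L0, L2})
        + edge_row f (\<sigma>, quad {L0, L3}) * edge_row g (\<sigma>, quad {L0, L1})
        - edge_row f (\<sigma>, quad {L0, L1}) * edge_row g (\<sigma>, quad {L0, L3})"
        unfolding D_def Let_def split third.simps edge_row_quads
          insert_commute[of L1 L0] insert_commute[of L2 L0] insert_commute[of L3 L0]
          insert_commute[of L2 L1] insert_commute[of L3 L1] insert_commute[of L3 L2]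
        by (simp only: ring_distribs)
      finally show "(\<Sum>p\<in>?P. D (\<sigma>, p)) = \<dots>" .
    qed
    finally show ?thesis ..
  qed
  have bij: "bij_betw (across gl) S S"
    by (rule bij_betw_byWitness[of _ "across gl"])
      (auto simp: S_def across_across[OF assms(1)] gmap_eq_iff[OF assms(1)] simp del: across.simps,
       auto simp: gmap_eq_iff[OF assms(1)])
  have "sum D S = (\<Sum>x\<in>S. D (across gl x))"
    by (rule sum.reindex_bij_betw[OF bij, symmetric])
  \<comment> \<open>Seen from the other side, the cyclic order of the face is reversed:
    \<open>b\<close> and \<open>c\<close> change roles. The value is therefore minus the term for
    the two edges meeting in \<open>b\<close>, whose index has \<open>fourth j a\<close> in place of
    \<open>a\<close>. Summing over \<open>S\<close> then gives
    \<open>sum D S = - sum D S\<close>.\<close>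
  also have "\<dots> = (\<Sum>x\<in>S. - D (case x of (\<sigma>, a, j) \<Rightarrow> (\<sigma>, fourth j a, j)))"
  proof (rule sum.cong[OF refl])
    fix x assume "x \<in> S"
    then obtain \<sigma> a j where x: "x = (\<sigma>, a, j)" and ja: "j \<noteq> a" by (auto simp: S_def)
    show "D (across gl x) = - D (case x of (\<sigma>, a, j) \<Rightarrow> (\<sigma>, fourth j a, j))"
      using ja third_neq[OF ja] third_fourth[OF ja]
      by (simp add: x D_def gmap_fourth[OF assms(1), symmetric] gmap_eq_iff[OF assms(1)] inv insert_commute Let_def)
  qed
  also have "\<dots> = - (\<Sum>x\<in>S. D (case x of (\<sigma>, a, j) \<Rightarrow> (\<sigma>, fourth j a, j)))"
    by (simp add: sum_negf)
  also have "(\<Sum>x\<in>S. D (case x of (\<sigma>, a, j) \<Rightarrow> (\<sigma>, fourth j a, j))) = sum D S"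
  proof (rule sum.reindex_bij_betw)
    have "third j a \<noteq> j" "fourth j (third j a) = a" "fourth j a \<noteq> j" "third j (fourth j a) = a" if "a \<noteq> j" for j a
      using that by (cases j; cases a; simp)+
    then show "bij_betw (\<lambda>x. case x of (\<sigma>, a, j) \<Rightarrow> (\<sigma>, fourth j a, j)) S S"
      by (intro bij_betw_byWitness[of _ "\<lambda>(\<sigma>, a, j). (\<sigma>, third j a, j)"]) (auto simp: S_def)
  qed
  finally show ?thesis using omega_D by simp
qed

section \<open>Pairing of two curves\<close>

definition side_flow :: "'t curve \<Rightarrow> 't side \<Rightarrow> int" where
  "side_flow \<alpha> f = (\<Sum>s\<leftarrow>\<alpha>. of_bool (seg_exit s = f) - of_bool (seg_entry s = f))"

lemma count_entry:
  assumes "singular_triangulation gl" "closed_normal_curve gl v \<alpha>"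
  shows "(\<Sum>s\<leftarrow>\<alpha>. of_bool (seg_entry s = f) :: int) = (\<Sum>s\<leftarrow>\<alpha>. of_bool (seg_exit s = across gl f))"
  using sum_list_entry_eq_exit[OF assms(2), of "\<lambda>g. of_bool (g = f)"] across_eq_iff[OF assms(1)]
  by simp

lemma sum_list_side_flow: "(\<Sum>s\<leftarrow>\<alpha>. side_flow [s] f) = side_flow \<alpha> f"
  by (simp add: side_flow_def)

lemma side_flow_across:
  assumes "singular_triangulation gl" "closed_normal_curve gl v \<alpha>"
  shows "side_flow \<alpha> (across gl f) = - side_flow \<alpha> f"
  unfolding side_flow_def sum_list_subtractf count_entry[OF assms] across_across[OF assms(1)]
  by simp

text \<open>Summed over a closed curve, the terms with \<open>side_flow\<close> and the terms counting the crossings of the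
  side \<open>(\<sigma>, i, j)\<close> are invariant under gluing, and the last term does not depend on \<open>j\<close>. Only the
  term with \<open>left_of\<close> survives when differences are summed over a second closed curve.\<close>

lemma seg_row_side_decomposition:
  assumes "normal_segment s" "i \<noteq> j"
  shows "seg_row s (\<sigma>, quad {i, j}) =
      side_flow [s] (\<sigma>, third i j, j) - side_flow [s] (\<sigma>, fourth i j, j)
    + 2 * of_bool (triangle_of (seg_entry s) = (\<sigma>, i) \<and> left_of s j)
    + (of_bool (seg_exit s = (\<sigma>, i, j)) + of_bool (seg_entry s = (\<sigma>, i, j)))
    + (case s of (\<sigma>', i', a, b) \<Rightarrow>
         if \<sigma>' = \<sigma> then (if i \<in> {i', a, b} then 0 else seg_eta s) - of_bool (i' = i) else 0)"
proof -
  obtain \<sigma>' i' a b where s: "s = (\<sigma>', i', a, b)" by (metis prod_cases4)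
  show ?thesis
  proof (cases "\<sigma>' = \<sigma>")
    case False
    then show ?thesis by (simp add: s seg_row_def side_flow_def)
  next
    case True
    have "i' \<noteq> a" "i' \<noteq> b" "a \<noteq> b" using assms(1) by (auto simp: s)
    then show ?thesis
      using assms(2) unfolding s side_flow_def seg_row_def True
      by (cases i; cases j; (simp; fail)?; cases i'; cases a; (simp; fail)?; cases b; (simp; fail)?;
          simp add: ccw_iff quad_pairs quad_distinct quad_uminus)
  qed
qed

lemma omega_curve_curve:
  assumes "singular_triangulation gl" "closed_normal_curve gl v \<alpha>" "closed_normal_curve gl v' \<beta>"
  shows "omega (\<lambda>q. curve_eta q \<alpha>) (\<lambda>q. curve_eta q \<beta>) = 2 * intersection_number \<alpha> \<beta>"
proof -
  \<comment> \<open>These are the four parts of \<open>seg_row_side_decomposition\<close> summed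
    over \<alpha>. The increment of \<open>P\<close> along a segment of \<beta> is exactly its
    intersection count with \<alpha>; the coefficient 2 of \<open>P\<close> is the factor in the
    conclusion.\<close>
  define P where "P = (\<lambda>(\<sigma>, i, j). \<Sum>s\<leftarrow>\<alpha>. of_bool (triangle_of (seg_entry s) = (\<sigma>, i) \<and> left_of s j) :: int)"
  define \<Psi> where "\<Psi> = (\<lambda>(\<sigma>, i, j). side_flow \<alpha> (\<sigma>, third i j, j) - side_flow \<alpha> (\<sigma>, fourth i j, j))"
  define X where "X = (\<lambda>f. (\<Sum>s\<leftarrow>\<alpha>. of_bool (seg_exit s = f) + of_bool (seg_entry s = f)) :: int)"
  define K where "K = (\<lambda>\<sigma> i. (\<Sum>s\<leftarrow>\<alpha>. (case s of (\<sigma>', i', a, b) \<Rightarrow>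
         if \<sigma>' = \<sigma> then (if i \<in> {i', a, b} then 0 else seg_eta s) - of_bool (i' = i) else 0)))"
  have row: "side_row (\<lambda>q. curve_eta q \<alpha>) (\<sigma>, i, j) = \<Psi> (\<sigma>, i, j) + 2 * P (\<sigma>, i, j) + X (\<sigma>, i, j) + K \<sigma> i"
    if "i \<noteq> j" for \<sigma> i j
  proof -
    have "side_row (\<lambda>q. curve_eta q \<alpha>) (\<sigma>, i, j) = (\<Sum>s\<leftarrow>\<alpha>.
      side_flow [s] (\<sigma>, third i j, j) - side_flow [s] (\<sigma>, fourth i j, j)
    + 2 * of_bool (triangle_of (seg_entry s) = (\<sigma>, i) \<and> left_of s j)
    + (of_bool (seg_exit s = (\<sigma>, i, j)) + of_bool (seg_entry s = (\<sigma>, i, j)))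
    + (case s of (\<sigma>', i', a, b) \<Rightarrow>
         if \<sigma>' = \<sigma> then (if i \<in> {i', a, b} then 0 else seg_eta s) - of_bool (i' = i) else 0))"
      unfolding curve_eta_eq side_row.simps
      by (intro arg_cong[of _ _ sum_list] map_cong refl seg_row_side_decomposition that
          closed_normal_curve_segments[OF assms(2)])
    then show ?thesis
      unfolding sum_list_addf sum_list_subtractf sum_list_const_mult sum_list_side_flow
      unfolding \<Psi>_def P_def X_def K_def sum_list_addf split .
  qed
  \<comment> \<open>Crossing the side reverses the flow and, the gluing being odd, also exchanges
    \<open>third\<close> and \<open>fourth\<close>; the two signs cancel.\<close>
  have inv\<Psi>: "side_invariant gl \<Psi>"
    unfolding side_invariant_def
  proof (intro allI impI)
    fix \<sigma> and i j :: lab assume ij: "i \<noteq> j"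
    let ?p = "gmap gl \<sigma> j"
    have "side_flow \<alpha> (nbr gl \<sigma> j, ?p c, ?p j) = - side_flow \<alpha> (\<sigma>, c, j)" for c
      using side_flow_across[OF assms(1,2), of "(\<sigma>, c, j)"] by simp
    then show "\<Psi> (across gl (\<sigma>, i, j)) = \<Psi> (\<sigma>, i, j)"
      using ij third_neq[OF ij]
      by (simp add: \<Psi>_def gmap_fourth[OF assms(1), symmetric] third_fourth[OF ij] gmap_eq_iff[OF assms(1)])
  qed
  \<comment> \<open>An exit through a side is an entry on its other copy, so crossing only exchanges
    the two summands.\<close>
  have invX: "side_invariant gl X"
    unfolding side_invariant_def X_def sum_list_addf count_entry[OF assms(1,2)] across_across[OF assms(1)]
    by simp
  have "omega (\<lambda>q. curve_eta q \<alpha>) (\<lambda>q. curve_eta q \<beta>) =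
    (\<Sum>s\<leftarrow>\<beta>. (\<Psi> (seg_exit s) - \<Psi> (seg_entry s)) + (X (seg_exit s) - X (seg_entry s))
       + 2 * (P (seg_exit s) - P (seg_entry s)))"
    unfolding omega_curve_eta[OF assms(3)]
  proof (intro arg_cong[of _ _ sum_list] map_cong refl)
    fix s assume "s \<in> set \<beta>"
    moreover obtain \<sigma> i a b where s: "s = (\<sigma>, i, a, b)" by (metis prod_cases4)
    ultimately have "i \<noteq> a" "i \<noteq> b"
      using closed_normal_curve_segments[OF assms(3), of s] by auto
    then show "side_row (\<lambda>q. curve_eta q \<alpha>) (seg_exit s) - side_row (\<lambda>q. curve_eta q \<alpha>) (seg_entry s) =
        \<Psi> (seg_exit s) - \<Psi> (seg_entry s) + (X (seg_exit s) - X (seg_entry s)) + 2 * (P (seg_exit s) - P (seg_entry s))"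
      unfolding s seg_exit.simps seg_entry.simps by (simp add: row del: side_row.simps)
  qed
  also have "\<dots> = 2 * (\<Sum>s\<leftarrow>\<beta>. P (seg_exit s) - P (seg_entry s))"
    unfolding sum_list_addf sum_list_const_mult
    using sum_list_side_invariant[OF assms(3) inv\<Psi>] sum_list_side_invariant[OF assms(3) invX] by simp
  also have "(\<Sum>s\<leftarrow>\<beta>. P (seg_exit s) - P (seg_entry s)) = (\<Sum>s'\<leftarrow>\<beta>. \<Sum>s\<leftarrow>\<alpha>. seg_intersection s s')"
  proof (intro arg_cong[of _ _ sum_list] map_cong refl)
    fix s' :: "'a segment"
    obtain \<sigma> i a b where s: "s' = (\<sigma>, i, a, b)" by (metis prod_cases4)
    show "P (seg_exit s') - P (seg_entry s') = (\<Sum>s\<leftarrow>\<alpha>. seg_intersection s s')"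
      unfolding s P_def by (simp add: sum_list_subtractf[symmetric] of_bool_conj if_distrib cong: if_cong)
        (intro arg_cong[of _ _ sum_list] map_cong; simp)
  qed
  also have "\<dots> = intersection_number \<alpha> \<beta>"
    unfolding intersection_number_def by (induction \<alpha>) (simp_all add: sum_list_addf)
  finally show ?thesis .
qed

section \<open>Counting simplices\<close>

abbreviation edge_rel :: "('t::finite) gluing \<Rightarrow> (('t \<times> lab set) \<times> ('t \<times> lab set)) set" where
  "edge_rel gl \<equiv> {((\<sigma>, x), (nbr gl \<sigma> i, gmap gl \<sigma> i ` x)) | \<sigma> i x. card x = 2 \<and> i \<notin> x}"

abbreviation vertex_rel :: "('t::finite) gluing \<Rightarrow> (('t \<times> lab) \<times> ('t \<times> lab)) set" where
  "vertex_rel gl \<equiv> {((\<sigma>, j), (nbr gl \<sigma> i, gmap gl \<sigma> i j)) | \<sigma> i j. j \<noteq> i}"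

abbreviation arrow_rel :: "('t::finite) gluing \<Rightarrow> (('t \<times> lab \<times> lab) \<times> ('t \<times> lab \<times> lab)) set" where
  "arrow_rel gl \<equiv> {((\<sigma>, i, k), (nbr gl \<sigma> j, gmap gl \<sigma> j i, gmap gl \<sigma> j k)) | \<sigma> i j k. distinct [i, j, k]}"

lemma gluing_back:
  assumes "singular_triangulation gl"
  shows "nbr gl (nbr gl \<sigma> i) (gmap gl \<sigma> i i) = \<sigma>"
    "gmap gl (nbr gl \<sigma> i) (gmap gl \<sigma> i i) (gmap gl \<sigma> i j) = j"
    "gmap gl (nbr gl \<sigma> i) (gmap gl \<sigma> i i) ` gmap gl \<sigma> i ` x = x"
proof -
  have "nbr gl (nbr gl \<sigma> i) (gmap gl \<sigma> i i) = \<sigma>"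
    and inv: "gmap gl (nbr gl \<sigma> i) (gmap gl \<sigma> i i) = inv (gmap gl \<sigma> i)"
    using singular_triangulationD(3)[OF assms, of \<sigma> i] by (simp_all add: nbr_def gmap_def)
  then show "nbr gl (nbr gl \<sigma> i) (gmap gl \<sigma> i i) = \<sigma>" by simp
  show *: "gmap gl (nbr gl \<sigma> i) (gmap gl \<sigma> i i) (gmap gl \<sigma> i j) = j" for j
    using permutes_inverses(2)[OF singular_triangulationD(1)[OF assms]] by (simp add: inv)
  then show "gmap gl (nbr gl \<sigma> i) (gmap gl \<sigma> i i) ` gmap gl \<sigma> i ` x = x"
    by (simp add: image_image)
qed

lemma equiv_rtrancl: "sym R \<Longrightarrow> equiv UNIV (R\<^sup>*)"
  by (intro equivI) (auto intro: sym_rtrancl trans_rtrancl refl_rtrancl)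

lemma inj_gmap: "singular_triangulation gl \<Longrightarrow> inj (gmap gl \<sigma> i)"
  using permutes_inj singular_triangulationD(1) by blast

lemma card_gmap_image: "singular_triangulation gl \<Longrightarrow> card (gmap gl \<sigma> i ` x) = card x"
  by (meson card_image inj_gmap inj_on_subset subset_UNIV)

lemma equiv_edge_rel:
  assumes "singular_triangulation gl"
  shows "equiv UNIV ((edge_rel gl)\<^sup>*)"
proof (intro equiv_rtrancl symI)
  fix y z assume "(y, z) \<in> edge_rel gl"
  then obtain \<sigma> i x where *: "y = (\<sigma>, x)" "z = (nbr gl \<sigma> i, gmap gl \<sigma> i ` x)" "card x = 2" "i \<notin> x"
    by blast
  have "card (gmap gl \<sigma> i ` x) = 2" "gmap gl \<sigma> i i \<notin> gmap gl \<sigma> i ` x"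
    using *(3,4) inj_gmap[OF assms, of \<sigma> i] by (auto simp: card_gmap_image[OF assms] inj_image_mem_iff)
  then have "((nbr gl \<sigma> i, gmap gl \<sigma> i ` x),
      (nbr gl (nbr gl \<sigma> i) (gmap gl \<sigma> i i), gmap gl (nbr gl \<sigma> i) (gmap gl \<sigma> i i) ` gmap gl \<sigma> i ` x)) \<in> edge_rel gl"
    by blast
  then show "(z, y) \<in> edge_rel gl"
    unfolding gluing_back[OF assms] *(1,2) .
qed

lemma equiv_vertex_rel:
  assumes "singular_triangulation gl"
  shows "equiv UNIV ((vertex_rel gl)\<^sup>*)"
proof (intro equiv_rtrancl symI)
  fix y z assume "(y, z) \<in> vertex_rel gl"
  then obtain \<sigma> i j where *: "y = (\<sigma>, j)" "z = (nbr gl \<sigma> i, gmap gl \<sigma> i j)" "j \<noteq> i"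
    by blast
  then have "gmap gl \<sigma> i j \<noteq> gmap gl \<sigma> i i" by (simp add: gmap_eq_iff[OF assms])
  then have "((nbr gl \<sigma> i, gmap gl \<sigma> i j),
      (nbr gl (nbr gl \<sigma> i) (gmap gl \<sigma> i i), gmap gl (nbr gl \<sigma> i) (gmap gl \<sigma> i i) (gmap gl \<sigma> i j))) \<in> vertex_rel gl"
    by blast
  then show "(z, y) \<in> vertex_rel gl"
    unfolding gluing_back[OF assms] *(1,2) .
qed

lemma equiv_arrow_rel:
  assumes "singular_triangulation gl"
  shows "equiv UNIV ((arrow_rel gl)\<^sup>*)"
proof (intro equiv_rtrancl symI)
  fix y z assume "(y, z) \<in> arrow_rel gl"
  then obtain \<sigma> i j k where *: "y = (\<sigma>, i, k)" "z = (nbr gl \<sigma> j, gmap gl \<sigma> j i, gmap gl \<sigma> j k)" "distinct [i, j, k]"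
    by blast
  then have "distinct [gmap gl \<sigma> j i, gmap gl \<sigma> j j, gmap gl \<sigma> j k]" by (simp add: gmap_eq_iff[OF assms])
  then have "((nbr gl \<sigma> j, gmap gl \<sigma> j i, gmap gl \<sigma> j k),
      (nbr gl (nbr gl \<sigma> j) (gmap gl \<sigma> j j), gmap gl (nbr gl \<sigma> j) (gmap gl \<sigma> j j) (gmap gl \<sigma> j i),
       gmap gl (nbr gl \<sigma> j) (gmap gl \<sigma> j j) (gmap gl \<sigma> j k))) \<in> arrow_rel gl"
    by blast
  then show "(z, y) \<in> arrow_rel gl"
    unfolding gluing_back[OF assms] *(1,2) .
qed

lemma edges_disjoint:
  assumes "singular_triangulation gl" "e \<in> edges gl" "e' \<in> edges gl" "y \<in> e" "y \<in> e'"
  shows "e = e'"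
proof -
  have "e \<in> UNIV // (edge_rel gl)\<^sup>*" "e' \<in> UNIV // (edge_rel gl)\<^sup>*"
    using assms(2,3) unfolding edges_def quotient_def by auto
  then show ?thesis using quotient_disj[OF equiv_edge_rel[OF assms(1)]] assms(4,5) by blast
qed

lemma vertices_disjoint:
  assumes "singular_triangulation gl" "v \<in> vertices gl" "v' \<in> vertices gl" "y \<in> v" "y \<in> v'"
  shows "v = v'"
  using quotient_disj[OF equiv_vertex_rel[OF assms(1)]] assms(2-) unfolding vertices_def by blast

lemma vertex_closed:
  assumes "singular_triangulation gl" "v \<in> vertices gl" "y \<in> v" "(y, z) \<in> (vertex_rel gl)\<^sup>*"
  shows "z \<in> v"
  using in_quotient_imp_closed[OF equiv_vertex_rel[OF assms(1)]] assms(2-) unfolding vertices_def by blast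

lemma edge_card:
  assumes "singular_triangulation gl" "e \<in> edges gl" "(\<sigma>, x) \<in> e"
  shows "card x = 2"
proof -
  obtain \<tau> y where y: "card y = 2" "((\<tau>, y), (\<sigma>, x)) \<in> (edge_rel gl)\<^sup>*"
    using assms(2,3) unfolding edges_def by (auto elim!: quotientE)
  from y(2) have "card (snd (\<sigma>, x)) = 2"
  proof induction
    case base
    show ?case using y(1) by simp
  next
    case (step a b)
    then show ?case by (auto simp: card_gmap_image[OF assms(1)])
  qed
  then show ?thesis by simp
qed

definition edge_class :: "('t::finite) gluing \<Rightarrow> 't \<times> lab set \<Rightarrow> ('t \<times> lab set) set" where
  "edge_class gl y = (edge_rel gl)\<^sup>* `` {y}"

definition vertex_class :: "('t::finite) gluing \<Rightarrow> 't \<times> lab \<Rightarrow> ('t \<times> lab) set" where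
  "vertex_class gl y = (vertex_rel gl)\<^sup>* `` {y}"

lemma edge_class_in: "card x = 2 \<Longrightarrow> edge_class gl (\<sigma>, x) \<in> edges gl"
  unfolding edges_def edge_class_def by (rule quotientI) simp

lemma edge_class_self: "y \<in> edge_class gl y"
  by (simp add: edge_class_def)

lemma edge_class_eq:
  assumes "singular_triangulation gl" "e \<in> edges gl" "y \<in> e"
  shows "edge_class gl y = e"
proof -
  obtain \<sigma> x where y: "y = (\<sigma>, x)" by fastforce
  then have "edge_class gl y \<in> edges gl"
    using edge_card[OF assms(1,2)] assms(3) edge_class_in by blast
  then show ?thesis using edges_disjoint[OF assms(1) _ assms(2) edge_class_self assms(3)] by blast
qed

lemma vertex_class_in: "vertex_class gl y \<in> vertices gl"
  unfolding vertices_def vertex_class_def by (rule quotientI) simp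

lemma vertex_class_self: "y \<in> vertex_class gl y"
  by (simp add: vertex_class_def)

lemma edge_invariant_edge_class:
  assumes "singular_triangulation gl"
  shows "edge_invariant gl (\<lambda>y. f (edge_class gl y))"
  unfolding edge_invariant_def
proof (intro allI impI)
  fix \<sigma> i and x :: "lab set" assume x: "card x = 2 \<and> i \<notin> x"
  then have "((\<sigma>, x), (nbr gl \<sigma> i, gmap gl \<sigma> i ` x)) \<in> edge_rel gl" by blast
  then have "(nbr gl \<sigma> i, gmap gl \<sigma> i ` x) \<in> edge_class gl (\<sigma>, x)"
    unfolding edge_class_def by (intro ImageI r_into_rtrancl) auto
  then show "f (edge_class gl (nbr gl \<sigma> i, gmap gl \<sigma> i ` x)) = f (edge_class gl (\<sigma>, x))"
    using edge_class_eq[OF assms edge_class_in] x by metis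
qed

lemma edge_invariant_mem:
  assumes "singular_triangulation gl" "e \<in> edges gl"
  shows "edge_invariant gl (\<lambda>y. of_bool (y \<in> e) :: int)"
proof -
  have *: "edge_class gl (\<sigma>, x) = e \<longleftrightarrow> (\<sigma>, x) \<in> e" for \<sigma> x
    using edge_class_eq[OF assms] edge_class_self by metis
  show ?thesis
    using edge_invariant_edge_class[OF assms(1), of "\<lambda>e'. of_bool (e' = e) :: int"]
    unfolding edge_invariant_def * .
qed

lemma quad_index_eq: "int (quad_index q e) = edge_row (\<lambda>y. of_bool (y \<in> e)) q"
proof -
  have "finite (snd q)" by simp
  then show ?thesis
    by (simp add: quad_index_def edge_row_def of_bool_def sum.If_cases Int_def)
qed

text \<open>Only this direction of \<open>card (link vertices) = 2 * card edges\<close> is needed; equality would require that no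
  edge is glued to itself with reversed orientation.\<close>

lemma card_arrow_classes:
  assumes "singular_triangulation gl"
  shows "card ({(\<sigma>, i, k). k \<noteq> i} // (arrow_rel gl)\<^sup>*) \<le> 2 * card (edges gl)"
proof -
  let ?R = "(arrow_rel gl)\<^sup>*"
  \<comment> \<open>One oriented representative per edge; every class of arrows will contain it or
    its reversal.\<close>
  define rep where "rep e = (SOME (\<sigma>, i, k). i \<noteq> k \<and> edge_class gl (\<sigma>, {i, k}) = e)" for e
  \<comment> \<open>A chain of gluings of unoriented edges carries an orientation along, but the
    prescribed orientation at its end may force the opposite one at its start.\<close>
  have lift: "((\<sigma>, i, k), (\<tau>, i', k')) \<in> ?R \<or> ((\<sigma>, k, i), (\<tau>, i', k')) \<in> ?R"
    if "((\<sigma>, {i, k}), (\<tau>, {i', k'})) \<in> (edge_rel gl)\<^sup>*" "i \<noteq> k" "i' \<noteq> k'" for \<sigma> i k \<tau> i' k'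
  proof -
    have "\<forall>i' k'. i' \<noteq> k' \<and> snd y = {i', k'} \<longrightarrow>
        ((\<sigma>, i, k), (fst y, i', k')) \<in> ?R \<or> ((\<sigma>, k, i), (fst y, i', k')) \<in> ?R"
      if "((\<sigma>, {i, k}), y) \<in> (edge_rel gl)\<^sup>*" for y
      using that
    proof induction
      case base
      then show ?case by (auto simp: doubleton_eq_iff)
    next
      case (step y z)
      then obtain \<rho> m x where yz: "y = (\<rho>, x)" "z = (nbr gl \<rho> m, gmap gl \<rho> m ` x)" "card x = 2" "m \<notin> x"
        by blast
      show ?case
      proof (intro allI impI)
        fix i' k' assume ik': "i' \<noteq> k' \<and> snd z = {i', k'}"
        obtain c d where cd: "c \<noteq> d" "x = {c, d}" using yz(3) by (rule card_2_labE)
        have "i' = gmap gl \<rho> m c \<and> k' = gmap gl \<rho> m d \<or> i' = gmap gl \<rho> m d \<and> k' = gmap gl \<rho> m c"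
          using ik' yz(2) cd(2) by (auto simp: doubleton_eq_iff)
        then obtain a b where ab: "a \<noteq> b" "x = {a, b}" "i' = gmap gl \<rho> m a" "k' = gmap gl \<rho> m b"
          using cd by (metis insert_commute)
        have "distinct [a, m, b]" using ab(1,2) yz(4) by auto
        then have "((\<rho>, a, b), (fst z, i', k')) \<in> arrow_rel gl"
          unfolding ab(3,4) yz(2) fst_conv by blast
        then show "((\<sigma>, i, k), (fst z, i', k')) \<in> ?R \<or> ((\<sigma>, k, i), (fst z, i', k')) \<in> ?R"
          using step.IH ab(1,2) yz(1) by (metis (no_types, lifting) fst_conv snd_conv rtrancl.rtrancl_into_rtrancl)
      qed
    qed
    from this[OF that(1)] show ?thesis using that(3) by simp
  qed
  have "{(\<sigma>, i, k). k \<noteq> i} // ?R \<subseteq>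
      (\<lambda>e. ?R `` {rep e}) ` edges gl \<union> (\<lambda>e. ?R `` {case rep e of (\<sigma>, i, k) \<Rightarrow> (\<sigma>, k, i)}) ` edges gl"
  proof
    fix C assume "C \<in> {(\<sigma>, i, k). k \<noteq> i} // ?R"
    then obtain \<tau> i' k' where C: "C = ?R `` {(\<tau>, i', k')}" "i' \<noteq> k'"
      by (auto elim!: quotientE)
    define e where "e = edge_class gl (\<tau>, {i', k'})"
    have "card {i', k'} = 2" using C(2) by simp
    then have e: "e \<in> edges gl" unfolding e_def by (rule edge_class_in)
    obtain \<sigma> i k where r: "rep e = (\<sigma>, i, k)" by (metis prod_cases3)
    have "case rep e of (\<sigma>, i, k) \<Rightarrow> i \<noteq> k \<and> edge_class gl (\<sigma>, {i, k}) = e"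
      unfolding rep_def by (rule someI[of _ "(\<tau>, i', k')"]) (simp add: C(2) e_def)
    then have ik: "i \<noteq> k" "edge_class gl (\<sigma>, {i, k}) = e" by (simp_all add: r)
    have "(\<tau>, {i', k'}) \<in> edge_class gl (\<sigma>, {i, k})"
      unfolding ik(2) e_def by (rule edge_class_self)
    then have "((\<sigma>, {i, k}), (\<tau>, {i', k'})) \<in> (edge_rel gl)\<^sup>*"
      unfolding edge_class_def by (rule Image_singleton_iff[THEN iffD1])
    from lift[OF this ik(1) C(2)] have "?R `` {(\<sigma>, i, k)} = C \<or> ?R `` {(\<sigma>, k, i)} = C"
      unfolding C(1) by (elim disjE) (rule disjI1 disjI2, erule equiv_class_eq[OF equiv_arrow_rel[OF assms]])+
    then show "C \<in> (\<lambda>e. ?R `` {rep e}) ` edges gl \<union> (\<lambda>e. ?R `` {case rep e of (\<sigma>, i, k) \<Rightarrow> (\<sigma>, k, i)}) ` edges gl"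
    proof
      assume "?R `` {(\<sigma>, i, k)} = C"
      then have "C = (\<lambda>e. ?R `` {rep e}) e" by (simp add: r)
      then show ?thesis using e by blast
    next
      assume "?R `` {(\<sigma>, k, i)} = C"
      then have "C = (\<lambda>e. ?R `` {case rep e of (\<sigma>, i, k) \<Rightarrow> (\<sigma>, k, i)}) e" by (simp add: r)
      then show ?thesis using e by blast
    qed
  qed
  then have "card ({(\<sigma>, i, k). k \<noteq> i} // ?R) \<le>
      card ((\<lambda>e. ?R `` {rep e}) ` edges gl \<union> (\<lambda>e. ?R `` {case rep e of (\<sigma>, i, k) \<Rightarrow> (\<sigma>, k, i)}) ` edges gl)"
    by (intro card_mono) auto
  also have "\<dots> \<le> card (edges gl) + card (edges gl)"
    by (intro order_trans[OF card_Un_le] add_mono card_image_le) auto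
  finally show ?thesis by simp
qed

text \<open>A vertex of a link is an end of an edge, that is, a class of arrows. Gluing keeps the
  tail of an arrow in its vertex class, so different links use different classes.\<close>

lemma sum_card_link_vertices:
  assumes "singular_triangulation gl"
  shows "(\<Sum>v\<in>vertices gl. card (link_vertices gl v)) \<le> 2 * card (edges gl)"
proof -
  let ?R = "(arrow_rel gl)\<^sup>*"
  have arrow_vertex: "((\<sigma>, i), (\<tau>, i')) \<in> (vertex_rel gl)\<^sup>*"
    if "((\<sigma>, i, k), (\<tau>, i', k')) \<in> ?R" for \<sigma> i k \<tau> i' k'
  proof -
    have "((\<sigma>, i), (fst y, fst (snd y))) \<in> (vertex_rel gl)\<^sup>*" if "((\<sigma>, i, k), y) \<in> ?R" for y
      using that
    proof induction
      case base
      then show ?case by simp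
    next
      case (step y z)
      then obtain \<rho> a b j where yz: "y = (\<rho>, a, b)" "z = (nbr gl \<rho> j, gmap gl \<rho> j a, gmap gl \<rho> j b)" "distinct [a, j, b]"
        by blast
      then have "((\<rho>, a), (nbr gl \<rho> j, gmap gl \<rho> j a)) \<in> vertex_rel gl" by auto
      then show ?case using step.IH unfolding yz by (simp add: rtrancl.rtrancl_into_rtrancl)
    qed
    from this[OF that] show ?thesis by simp
  qed
  have disj: "link_vertices gl v \<inter> link_vertices gl v' = {}"
    if v: "v \<in> vertices gl" "v' \<in> vertices gl" "v \<noteq> v'" for v v'
  proof (rule ccontr)
    assume "link_vertices gl v \<inter> link_vertices gl v' \<noteq> {}"
    then obtain C where C: "C \<in> link_vertices gl v" "C \<in> link_vertices gl v'" by blast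
    obtain \<sigma> i k where 1: "C = ?R `` {(\<sigma>, i, k)}" "(\<sigma>, i) \<in> v"
      using C(1) unfolding link_vertices_def by (auto elim!: quotientE)
    obtain \<tau> i' k' where 2: "C = ?R `` {(\<tau>, i', k')}" "(\<tau>, i') \<in> v'"
      using C(2) unfolding link_vertices_def by (auto elim!: quotientE)
    have "(\<tau>, i', k') \<in> C" unfolding 2(1) by simp
    then have "((\<sigma>, i, k), (\<tau>, i', k')) \<in> ?R" unfolding 1(1) by simp
    from arrow_vertex[OF this] have "(\<tau>, i') \<in> v"
      using vertex_closed[OF assms v(1) 1(2)] by blast
    then show False using vertices_disjoint[OF assms v(1,2) _ 2(2)] v(3) by blast
  qed
  have "(\<Sum>v\<in>vertices gl. card (link_vertices gl v)) = card (\<Union>v\<in>vertices gl. link_vertices gl v)"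
    using disj by (intro card_UN_disjoint[symmetric]) auto
  also have "\<dots> \<le> card ({(\<sigma>, i, k). k \<noteq> i} // ?R)"
    by (intro card_mono) (auto simp: link_vertices_def quotient_def)
  also have "\<dots> \<le> 2 * card (edges gl)" by (rule card_arrow_classes[OF assms])
  finally show ?thesis .
qed

text \<open>Every triangle has three sides and a glued class has at most two. This direction bounds
  \<open>link_euler\<close> from above.\<close>

lemma card_link_edges:
  fixes gl :: "('t::finite) gluing"
  shows "3 * card v \<le> 2 * card (link_edges gl v)"
proof -
  let ?r = "{(f, f'). f' = f \<or> f' = across gl f}"
  have "card (UNIV - {i}) = 3" for i :: lab
    by (cases i) (simp_all add: UNIV_lab card_Diff_singleton_if)
  then have "card (SIGMA p:v. UNIV - {snd p}) = 3 * card v" by (simp add: card_SigmaI)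
  also have "card (SIGMA p:v. UNIV - {snd p}) = card ((\<lambda>((\<sigma>, i), j). (\<sigma>, i, j)) ` (SIGMA p:v. UNIV - {snd p}))"
    by (intro card_image[symmetric]) (auto simp: inj_on_def)
  also have "(\<lambda>((\<sigma>, i), j). (\<sigma>, i, j)) ` (SIGMA p:v. UNIV - {snd p}) = triangle_sides v"
    by (force simp: triangle_sides_def image_iff)
  finally have "3 * card v = card (triangle_sides v)" by simp
  also have "\<dots> \<le> card (\<Union>(link_edges gl v))"
    by (intro card_mono) (auto simp: link_edges_def quotient_def)
  also have "\<dots> \<le> (\<Sum>C\<in>link_edges gl v. card C)"
    by (rule card_Union_le_sum_card)
  also have "\<dots> \<le> (\<Sum>C\<in>link_edges gl v. 2)"
  proof (rule sum_mono)
    fix C assume "C \<in> link_edges gl v"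
    then obtain f where "C = ?r `` {f}" unfolding link_edges_def by (auto elim!: quotientE)
    then have "C = {f, across gl f}" by auto
    then show "card C \<le> 2" by (simp add: card_insert_if)
  qed
  finally show ?thesis by simp
qed

text \<open>By \<open>card_link_edges\<close>, the Euler characteristic of a link is at most its
  number of vertices minus half its number of triangles. Over all links there are at most two
  vertices per edge and at least four triangles per simplex.\<close>

lemma sum_link_euler_le:
  fixes gl :: "('t::finite) gluing"
  assumes "singular_triangulation gl"
  shows "(\<Sum>v\<in>vertices gl. link_euler gl v) \<le> 2 * int (card (edges gl)) - 2 * int CARD('t)"
proof -
  have "card (UNIV :: lab set) = 4" by (simp add: UNIV_lab)
  then have "4 * CARD('t) = card (UNIV :: ('t \<times> lab) set)" by (simp add: card_cartesian_product flip: UNIV_Times_UNIV)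
  also have "UNIV \<subseteq> \<Union>(vertices gl)"
    using vertex_class_in[of gl] vertex_class_self[of _ gl] by blast
  then have "card (UNIV :: ('t \<times> lab) set) \<le> card (\<Union>(vertices gl))"
    by (intro card_mono) simp_all
  also have "card (\<Union>(vertices gl)) \<le> (\<Sum>v\<in>vertices gl. card v)" by (rule card_Union_le_sum_card)
  finally have T: "4 * int CARD('t) \<le> (\<Sum>v\<in>vertices gl. int (card v))"
    by (simp flip: of_nat_sum)
  have "2 * link_euler gl v \<le> 2 * int (card (link_vertices gl v)) - int (card v)" for v
    using card_link_edges[of v gl] unfolding link_euler_def by simp
  then have "(\<Sum>v\<in>vertices gl. 2 * link_euler gl v) \<le> (\<Sum>v\<in>vertices gl. 2 * int (card (link_vertices gl v)) - int (card v))"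
    by (rule sum_mono)
  also have "\<dots> \<le> 4 * int (card (edges gl)) - 4 * int CARD('t)"
    using T sum_card_link_vertices[OF assms]
    by (simp add: sum_subtractf flip: sum_distrib_left of_nat_sum)
  finally show ?thesis by (simp flip: sum_distrib_left)
qed

text \<open>The genera of all links add up to \<open>card I\<close>, so their Euler characteristics
  add up to twice \<open>|V| - |I|\<close>, to be compared with
  \<open>sum_link_euler_le\<close>.\<close>

lemma count_simplices:
  fixes gl :: "('t::finite) gluing" and I :: "('l::finite) set"
  assumes "singular_triangulation gl" "canonical_curve_system gl I vtx lon mer"
  shows "CARD('t) + card (vertices gl) \<le> card (edges gl) + card I"
proof -
  have "card I = card (\<Union>v\<in>vertices gl. {j \<in> I. vtx j = v})"
    using assms(2) unfolding canonical_curve_system_def by (intro arg_cong[of _ _ card]) auto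
  also have "\<dots> = (\<Sum>v\<in>vertices gl. card {j \<in> I. vtx j = v})"
    by (rule card_UN_disjoint) auto
  finally have I: "int (card I) = (\<Sum>v\<in>vertices gl. int (card {j \<in> I. vtx j = v}))" by simp
  have "link_euler gl v = 2 - 2 * int (card {j \<in> I. vtx j = v})" if "v \<in> vertices gl" for v
    using assms(2) that unfolding canonical_curve_system_def canonical_generators_def link_genus_def by blast
  then have "(\<Sum>v\<in>vertices gl. link_euler gl v) = 2 * int (card (vertices gl)) - 2 * int (card I)"
    by (simp add: sum_subtractf I sum_distrib_left)
  then show ?thesis using sum_link_euler_le[OF assms(1)] by simp
qed

section \<open>Smooth inverses\<close>

lemma has_derivative_vec_lambda:
  fixes f :: "'a::real_normed_vector \<Rightarrow> 'i::finite \<Rightarrow> 'b::euclidean_space"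
  assumes "\<And>i. ((\<lambda>x. f x i) has_derivative (\<lambda>h. f' h i)) (at a within S)"
  shows "((\<lambda>x. \<chi> i. f x i) has_derivative (\<lambda>h. \<chi> i. f' h i)) (at a within S)"
  using assms
  by (subst has_derivative_componentwise_within)
    (auto simp: Basis_vec_def inner_axis intro: has_derivative_inner_left)

text \<open>Since \<open>S\<close> is open, derivatives at its points see only values inside
  \<open>S\<close>; elsewhere the functions may differ.\<close>

lemma C_k_on_cong:
  assumes "open S" "\<And>x. x \<in> S \<Longrightarrow> f x = g x" "C_k_on k S f"
  shows "C_k_on k S g"
  using assms(2,3)
proof (induction k arbitrary: f g)
  case 0
  then show ?case by (simp cong: continuous_on_cong)
next
  case (Suc k)
  have D: "(g has_derivative frechet_derivative f (at x)) (at x)" if "x \<in> S" for x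
  proof (rule has_derivative_transform_within_open[OF _ assms(1) that])
    show "(f has_derivative frechet_derivative f (at x)) (at x)"
      using Suc.prems(2) that by (simp add: frechet_derivative_works[symmetric])
  qed (simp add: Suc.prems(1))
  show ?case
  proof (simp, intro conjI ballI allI)
    fix x assume "x \<in> S"
    then show "g differentiable at x" using D by (auto simp: differentiable_def)
  next
    fix d
    have "C_k_on k S (\<lambda>x. frechet_derivative f (at x) d)" using Suc.prems(2) by simp
    moreover have "frechet_derivative f (at x) d = frechet_derivative g (at x) d" if "x \<in> S" for x
      using frechet_derivative_at[OF D[OF that]] by simp
    ultimately show "C_k_on k S (\<lambda>x. frechet_derivative g (at x) d)"
      by (rule Suc.IH[rotated])
  qed
qed

text \<open>Smoothness by invariance: a class of functions closed under directional derivatives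
  consists of smooth functions, and no higher derivative has to be computed.\<close>

lemma C_k_on_coinduct:
  assumes "open S" "P f"
    and step: "\<And>f. P f \<Longrightarrow> \<exists>D. (\<forall>x\<in>S. (f has_derivative D x) (at x)) \<and> (\<forall>d. P (\<lambda>x. D x d))"
  shows "C_k_on k S f"
  using assms(2)
proof (induction k arbitrary: f)
  case 0
  obtain D where "\<forall>x\<in>S. (f has_derivative D x) (at x)" using step[OF 0] by blast
  then show ?case
    by (auto intro!: continuous_at_imp_continuous_on has_derivative_continuous)
next
  case (Suc k)
  obtain D where D: "\<forall>x\<in>S. (f has_derivative D x) (at x)" "\<forall>d. P (\<lambda>x. D x d)"
    using step[OF Suc.prems] by blast
  show ?case
  proof (simp, intro conjI ballI allI)
    fix x assume "x \<in> S"
    then show "f differentiable at x" using D by (auto simp: differentiable_def)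
  next
    fix d
    have eq: "D x d = frechet_derivative f (at x) d" if "x \<in> S" for x
      using frechet_derivative_at[of f "D x" x] D(1) that by simp
    have "C_k_on k S (\<lambda>x. D x d)" by (rule Suc.IH) (simp add: D(2))
    with eq show "C_k_on k S (\<lambda>x. frechet_derivative f (at x) d)"
      by (rule C_k_on_cong[OF assms(1)])
  qed
qed

text \<open>Rational functions without poles on \<open>U\<close>. The class is stable under partial
  derivatives and determinants, hence under Cramer's rule. Logarithms are outside it, but their
  derivatives are inside.\<close>

inductive ratfun :: "(complex ^ 'n) set \<Rightarrow> (complex ^ 'n \<Rightarrow> complex) \<Rightarrow> bool" for U where
  const: "ratfun U (\<lambda>w. c)"
| coord: "ratfun U (\<lambda>w. w $ i)"
| add: "ratfun U f \<Longrightarrow> ratfun U g \<Longrightarrow> ratfun U (\<lambda>w. f w + g w)"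
| mult: "ratfun U f \<Longrightarrow> ratfun U g \<Longrightarrow> ratfun U (\<lambda>w. f w * g w)"
| inverse: "ratfun U f \<Longrightarrow> (\<And>w. w \<in> U \<Longrightarrow> f w \<noteq> 0) \<Longrightarrow> ratfun U (\<lambda>w. inverse (f w))"

lemma ratfun_sum:
  "(\<And>i. i \<in> A \<Longrightarrow> ratfun U (f i)) \<Longrightarrow> ratfun U (\<lambda>w. \<Sum>i\<in>A. f i w)"
  by (induction A rule: infinite_finite_induct) (auto intro: ratfun.intros)

lemma ratfun_prod:
  "(\<And>i. i \<in> A \<Longrightarrow> ratfun U (f i)) \<Longrightarrow> ratfun U (\<lambda>w. \<Prod>i\<in>A. f i w)"
  by (induction A rule: infinite_finite_induct) (auto intro: ratfun.intros)

lemma ratfun_det: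
  fixes A :: "complex ^ 'n \<Rightarrow> complex ^ 'm ^ 'm"
  assumes "\<And>i j. ratfun U (\<lambda>w. A w $ i $ j)"
  shows "ratfun U (\<lambda>w. det (A w))"
  unfolding det_def
  by (intro ratfun_sum ratfun.mult ratfun.const ratfun_prod assms)

text \<open>The derivative is given by its coefficients rather than as a linear map, so that they
  lie in the class again and differentiation can be iterated.\<close>

lemma ratfun_has_derivative:
  fixes f :: "complex ^ ('n::finite) \<Rightarrow> complex"
  assumes "ratfun U f"
  shows "\<exists>D. (\<forall>i. ratfun U (D i)) \<and>
    (\<forall>w\<in>U. (f has_derivative (\<lambda>h. \<Sum>i\<in>UNIV. D i w * h $ i)) (at w))"
  using assms
proof induction
  case (const c)
  show ?case
    by (rule exI[of _ "\<lambda>i w. 0"]) (auto intro: ratfun.const)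
next
  case (coord j)
  have "((\<lambda>w. w $ j) has_derivative (\<lambda>h. \<Sum>i\<in>UNIV. of_bool (i = j) * h $ i)) (at w)"
    for w :: "complex ^ 'n"
    by (rule has_derivative_eq_rhs[OF bounded_linear_imp_has_derivative[OF bounded_linear_vec_nth]])
      (simp add: of_bool_def mult_delta_left)
  then show ?case
    by (intro exI[of _ "\<lambda>i w. of_bool (i = j)"]) (auto intro: ratfun.const)
next
  case (add f g)
  then obtain D E where D: "\<And>i. ratfun U (D i)" "\<And>i. ratfun U (E i)"
    "\<And>w. w \<in> U \<Longrightarrow> (f has_derivative (\<lambda>h. \<Sum>i\<in>UNIV. D i w * h $ i)) (at w)"
    "\<And>w. w \<in> U \<Longrightarrow> (g has_derivative (\<lambda>h. \<Sum>i\<in>UNIV. E i w * h $ i)) (at w)"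
    by blast
  have "((\<lambda>w. f w + g w) has_derivative (\<lambda>h. \<Sum>i\<in>UNIV. (D i w + E i w) * h $ i)) (at w)"
    if "w \<in> U" for w
    by (rule has_derivative_eq_rhs[OF has_derivative_add[OF D(3,4)[OF that]]])
      (simp add: algebra_simps sum.distrib)
  then show ?case
    using D(1,2) by (intro exI[of _ "\<lambda>i w. D i w + E i w"]) (auto intro: ratfun.add)
next
  case (mult f g)
  then obtain D E where D: "\<And>i. ratfun U (D i)" "\<And>i. ratfun U (E i)"
    "\<And>w. w \<in> U \<Longrightarrow> (f has_derivative (\<lambda>h. \<Sum>i\<in>UNIV. D i w * h $ i)) (at w)"
    "\<And>w. w \<in> U \<Longrightarrow> (g has_derivative (\<lambda>h. \<Sum>i\<in>UNIV. E i w * h $ i)) (at w)"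
    by blast
  have "((\<lambda>w. f w * g w) has_derivative (\<lambda>h. \<Sum>i\<in>UNIV. (f w * E i w + D i w * g w) * h $ i)) (at w)"
    if "w \<in> U" for w
    by (rule has_derivative_eq_rhs[OF has_derivative_mult[OF D(3,4)[OF that]]])
      (simp add: algebra_simps sum.distrib sum_distrib_left sum_distrib_right)
  moreover have "ratfun U (\<lambda>w. f w * E i w + D i w * g w)" for i
    by (intro ratfun.add ratfun.mult D(1,2) mult.hyps)
  ultimately show ?case
    by (intro exI[of _ "\<lambda>i w. f w * E i w + D i w * g w"]) auto
next
  case (inverse f)
  then obtain D where D: "\<And>i. ratfun U (D i)"
    "\<And>w. w \<in> U \<Longrightarrow> (f has_derivative (\<lambda>h. \<Sum>i\<in>UNIV. D i w * h $ i)) (at w)"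
    by blast
  have "((\<lambda>w. inverse (f w)) has_derivative
      (\<lambda>h. \<Sum>i\<in>UNIV. (-1) * (inverse (f w) * (D i w * inverse (f w))) * h $ i)) (at w)"
    if "w \<in> U" for w
    by (rule has_derivative_eq_rhs[OF Deriv.has_derivative_inverse[OF inverse.hyps(2)[OF that] D(2)[OF that]]])
      (simp add: algebra_simps sum_distrib_left sum_negf)
  moreover have "ratfun U (\<lambda>w. (-1) * (inverse (f w) * (D i w * inverse (f w))))" for i
    by (intro ratfun.mult ratfun.const ratfun.inverse D(1) inverse.hyps)
  ultimately show ?case
    by (intro exI[of _ "\<lambda>i w. (-1) * (inverse (f w) * (D i w * inverse (f w)))"]) auto
qed

lemma ratfun_continuous_on:
  fixes f :: "complex ^ ('n::finite) \<Rightarrow> complex"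
  assumes "ratfun U f"
  shows "continuous_on U f"
proof (rule continuous_at_imp_continuous_on, rule ballI)
  fix w assume "w \<in> U"
  then obtain f' where "(f has_derivative f') (at w)"
    using ratfun_has_derivative[OF assms] by blast
  then show "isCont f w" by (rule has_derivative_continuous)
qed

lemma ratfun_family_has_derivative:
  fixes \<phi> :: "'m \<Rightarrow> complex ^ ('n::finite) \<Rightarrow> complex"
  assumes "\<And>j. ratfun U (\<phi> j)"
  obtains E where "\<And>j i. ratfun U (E j i)"
    "\<And>j w. w \<in> U \<Longrightarrow> (\<phi> j has_derivative (\<lambda>h. \<Sum>i\<in>UNIV. E j i w * h $ i)) (at w)"
proof -
  have "\<exists>E. \<forall>j. (\<forall>i. ratfun U (E j i)) \<and>
      (\<forall>w\<in>U. (\<phi> j has_derivative (\<lambda>h. \<Sum>i\<in>UNIV. E j i w * h $ i)) (at w))"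
    by (rule choice) (intro allI ratfun_has_derivative assms)
  then show thesis using that by blast
qed

lemma C_k_on_ratfun:
  fixes \<phi> :: "'m::finite \<Rightarrow> complex ^ ('n::finite) \<Rightarrow> complex"
  assumes "open U" "\<And>j. ratfun U (\<phi> j)"
  shows "C_k_on k U (\<lambda>w. \<chi> j. \<phi> j w)"
proof (rule C_k_on_coinduct[OF assms(1), of "\<lambda>f. \<exists>\<phi>. (\<forall>j. ratfun U (\<phi> j)) \<and> f = (\<lambda>w. \<chi> j. \<phi> j w)"])
  show "\<exists>\<psi>. (\<forall>j. ratfun U (\<psi> j)) \<and> (\<lambda>w. \<chi> j. \<phi> j w) = (\<lambda>w. \<chi> j. \<psi> j w)"
    using assms(2) by blast
next
  fix f :: "complex ^ 'n \<Rightarrow> complex ^ 'm"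
  assume "\<exists>\<phi>. (\<forall>j. ratfun U (\<phi> j)) \<and> f = (\<lambda>w. \<chi> j. \<phi> j w)"
  then obtain \<phi> where \<phi>: "\<And>j. ratfun U (\<phi> j)" "f = (\<lambda>w. \<chi> j. \<phi> j w)" by blast
  obtain E where E: "\<And>j i. ratfun U (E j i)"
    "\<And>j w. w \<in> U \<Longrightarrow> (\<phi> j has_derivative (\<lambda>h. \<Sum>i\<in>UNIV. E j i w * h $ i)) (at w)"
    by (rule ratfun_family_has_derivative[of U \<phi>]) (use \<phi>(1) in blast)+
  define D where "D w h = (\<chi> j. \<Sum>i\<in>UNIV. E j i w * h $ i)" for w h
  have "(f has_derivative D w) (at w)" if "w \<in> U" for w
    unfolding \<phi>(2) D_def by (intro has_derivative_vec_lambda E(2)[OF that])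
  moreover have "\<exists>\<psi>. (\<forall>j. ratfun U (\<psi> j)) \<and> (\<lambda>w. D w h) = (\<lambda>w. \<chi> j. \<psi> j w)" for h
  proof (intro exI conjI allI)
    show "ratfun U (\<lambda>w. \<Sum>i\<in>UNIV. E j i w * h $ i)" for j
      by (intro ratfun_sum ratfun.mult ratfun.const E(1))
  qed (simp add: D_def)
  ultimately show "\<exists>D. (\<forall>x\<in>U. (f has_derivative D x) (at x)) \<and>
      (\<forall>h. \<exists>\<psi>. (\<forall>j. ratfun U (\<psi> j)) \<and> (\<lambda>w. D w h) = (\<lambda>w. \<chi> j. \<psi> j w))"
    by blast
qed

text \<open>A primitive of a rational matrix field has a smooth local inverse: by Cramer's rule the
  derivative of the inverse is a rational function of the inverse itself, so that rational
  functions of the inverse are closed under differentiation.\<close>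

lemma rational_inverse_function:
  fixes F :: "complex ^ ('n::finite) \<Rightarrow> complex ^ 'n" and A :: "complex ^ 'n \<Rightarrow> complex ^ 'n ^ 'n"
  assumes "open U" and A: "\<And>i j. ratfun U (\<lambda>w. A w $ i $ j)"
    and F: "\<And>w. w \<in> U \<Longrightarrow> (F has_derivative (*v) (A w)) (at w)"
    and det: "\<And>w. w \<in> U \<Longrightarrow> det (A w) \<noteq> 0" and "w0 \<in> U"
  obtains U' V g where "open U'" "U' \<subseteq> U" "w0 \<in> U'" "open V" "homeomorphism U' V F g"
    "\<And>(aff :: complex ^ ('m::finite) \<Rightarrow> complex ^ 'n) lin k.
       (\<And>y. (aff has_derivative lin) (at y)) \<Longrightarrow> C_k_on k (aff -` V) (\<lambda>y. g (aff y))"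
proof -
  have bl: "bounded_linear ((*v) (A w))" for w by simp
  have F': "(F has_derivative blinfun_apply (Blinfun ((*v) (A w)))) (at w)" if "w \<in> U" for w
    using F[OF that] by (simp add: bounded_linear_Blinfun_apply[OF bl])
  have cont: "continuous_on U (\<lambda>w. Blinfun ((*v) (A w)))"
  proof (rule continuous_on_blinfun_componentwise)
    fix i :: "complex ^ 'n"
    have "continuous_on U (\<lambda>w. \<chi> j. \<Sum>k\<in>UNIV. A w $ j $ k * i $ k)"
      by (intro continuous_intros ratfun_continuous_on[OF A])
    then show "continuous_on U (\<lambda>w. blinfun_apply (Blinfun ((*v) (A w))) i)"
      by (simp add: bounded_linear_Blinfun_apply[OF bl] matrix_vector_mult_def)
  qed
  obtain B where B: "B ** A w0 = mat 1"
    using det[OF \<open>w0 \<in> U\<close>] by (metis invertible_det_nz invertible_left_inverse)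
  have "Blinfun ((*v) B) o\<^sub>L Blinfun ((*v) (A w0)) = id_blinfun"
    by (rule blinfun_eqI) (simp add: bounded_linear_Blinfun_apply matrix_vector_mul_assoc B)
  from inverse_function_theorem[OF \<open>open U\<close> F' cont \<open>w0 \<in> U\<close> this]
  obtain U' V g g' where U': "open U'" "U' \<subseteq> U" "w0 \<in> U'" "open V" "homeomorphism U' V F g"
    and g: "\<And>y. y \<in> V \<Longrightarrow> (g has_derivative g' y) (at y)"
      "\<And>y. y \<in> V \<Longrightarrow> g' y = inv (blinfun_apply (Blinfun ((*v) (A (g y)))))"
      "\<And>y. y \<in> V \<Longrightarrow> bij (blinfun_apply (Blinfun ((*v) (A (g y)))))"
    by metis
  have gU: "g y \<in> U" if "y \<in> V" for y
    using U'(2,5) that by (auto simp: homeomorphism_def)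
  \<comment> \<open>Cramer's quotient for the \<open>i\<close>-th entry of the solution
    \<open>x\<close> of \<open>A w *v x = d\<close>.\<close>
  define cr where "cr d i w = det (\<chi> j k. if k = i then d $ j else A w $ j $ k) * inverse (det (A w))" for d i w
  have cr: "ratfun U (cr d i)" for d i
  proof -
    have "ratfun U (\<lambda>w. (\<chi> j k. if k = i then d $ j else A w $ j $ k) $ j $ k)" for j k
      by (cases "k = i") (simp_all add: ratfun.const A)
    then show ?thesis
      unfolding cr_def by (intro ratfun.mult ratfun.inverse ratfun_det A det)
  qed
  have g': "g' y d $ i = cr d i (g y)" if "y \<in> V" for y d i
  proof -
    have "A (g y) *v g' y d = d"
      using g(3)[OF that] bij_is_surj surj_f_inv_f
      by (metis g(2)[OF that] bounded_linear_Blinfun_apply[OF bl])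
    then show ?thesis
      using cramer[OF det[OF gU[OF that]]] by (simp add: cr_def divide_inverse)
  qed
  show thesis
  proof (rule that[OF U'])
    fix aff :: "complex ^ 'm \<Rightarrow> complex ^ 'n" and lin k
    assume aff: "\<And>y. (aff has_derivative lin) (at y)"
    have "continuous_on UNIV aff"
      using has_derivative_continuous[OF aff] by (auto intro!: continuous_at_imp_continuous_on)
    then have open': "open (aff -` V)"
      by (rule open_vimage[OF U'(4)])
    define G where "G y = g (aff y)" for y
    let ?P = "\<lambda>f. \<exists>\<phi>. (\<forall>j. ratfun U (\<phi> j)) \<and> f = (\<lambda>y. \<chi> j. \<phi> j (G y))"
    show "C_k_on k (aff -` V) (\<lambda>y. g (aff y))"
    proof (rule C_k_on_coinduct[OF open', of ?P])
      show "\<exists>\<phi>. (\<forall>j. ratfun U (\<phi> j)) \<and> (\<lambda>y. g (aff y)) = (\<lambda>y. \<chi> j. \<phi> j (G y))"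
        by (intro exI[of _ "\<lambda>j w. w $ j"]) (auto simp: G_def ratfun.coord)
    next
      fix f :: "complex ^ 'm \<Rightarrow> complex ^ 'n"
      assume "?P f"
      then obtain \<phi> where \<phi>: "\<And>j. ratfun U (\<phi> j)" "f = (\<lambda>y. \<chi> j. \<phi> j (G y))" by blast
      obtain E where E: "\<And>j i. ratfun U (E j i)"
        "\<And>j w. w \<in> U \<Longrightarrow> (\<phi> j has_derivative (\<lambda>h. \<Sum>i\<in>UNIV. E j i w * h $ i)) (at w)"
        by (rule ratfun_family_has_derivative[of U \<phi>]) (use \<phi>(1) in blast)+
      \<comment> \<open>The derivative of \<open>aff\<close> is the same at all points, so
        \<open>lin d\<close> is a constant vector inside \<open>cr\<close>, and each component of
        the derivative is again a rational function of \<open>G y\<close>.\<close>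
      define D where "D y d = (\<chi> j. \<Sum>i\<in>UNIV. E j i (G y) * cr (lin d) i (G y))" for y d
      have "(f has_derivative D y) (at y)" if "y \<in> aff -` V" for y
      proof -
        have y: "aff y \<in> V" using that by simp
        have dG: "(G has_derivative (\<lambda>d. g' (aff y) (lin d))) (at y)"
          unfolding G_def by (rule has_derivative_compose[OF aff g(1)[OF y]])
        have "G y \<in> U" unfolding G_def by (rule gU[OF y])
        then have "((\<lambda>y. \<phi> j (G y)) has_derivative
            (\<lambda>d. \<Sum>i\<in>UNIV. E j i (G y) * g' (aff y) (lin d) $ i)) (at y)" for j
          by (rule has_derivative_compose[OF dG E(2)])
        then show ?thesis
          unfolding \<phi>(2) D_def g'[OF y, folded G_def] by (rule has_derivative_vec_lambda)
      qed
      moreover have "?P (\<lambda>y. D y d)" for d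
      proof (intro exI conjI allI)
        show "ratfun U (\<lambda>w. \<Sum>i\<in>UNIV. E j i w * cr (lin d) i w)" for j
          by (intro ratfun_sum ratfun.mult cr E(1))
      qed (simp add: D_def)
      ultimately show "\<exists>D. (\<forall>y\<in>aff -` V. (f has_derivative D y) (at y)) \<and> (\<forall>d. ?P (\<lambda>y. D y d))"
        by blast
    qed
  qed
qed

section \<open>Lagrangian subspaces and logarithmic forms\<close>

definition symp :: "(real ^ 'n) \<times> (real ^ 'n) \<Rightarrow> (real ^ 'n) \<times> (real ^ 'n) \<Rightarrow> real" where
  "symp u v = fst u \<bullet> snd v - snd u \<bullet> fst v"

lemma symp_eq_inner: "symp u v = u \<bullet> (snd v, - fst v)"
  by (simp add: symp_def inner_prod_def)

lemma symp_swap: "symp v u = - symp u v"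
  by (simp add: symp_def inner_commute)

lemma symp_span_right:
  assumes "v \<in> span S" "\<And>s. s \<in> S \<Longrightarrow> symp u s = 0"
  shows "symp u v = 0"
proof -
  have "linear (symp u)"
    by (rule linearI) (simp_all add: symp_def inner_add_right algebra_simps)
  then have "subspace {v. symp u v = 0}" by (rule linear_subspace_kernel)
  then show ?thesis using span_induct[OF assms(1)] assms(2) by blast
qed

lemma symp_span:
  assumes "u \<in> span S" "v \<in> span T" "\<And>s t. s \<in> S \<Longrightarrow> t \<in> T \<Longrightarrow> symp s t = 0"
  shows "symp u v = 0"
proof -
  have "symp u t = 0" if "t \<in> T" for t
    using symp_span_right[OF assms(1), of t] assms(3)[OF _ that] by (simp add: symp_swap[of _ t])
  then show ?thesis by (rule symp_span_right[OF assms(2)])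
qed

text \<open>The rotation \<open>J\<close> turns the symplectic form into the inner product and thus
  maps the span of an isotropic set into its orthogonal complement. Comparing dimensions gives the
  bound. In the extremal case the complement equals the image under \<open>J\<close>, which is
  isotropic like the span itself.\<close>

lemma isotropic_subspace:
  fixes L :: "((real ^ 'n::finite) \<times> (real ^ 'n)) set"
  assumes iso: "\<And>u v. u \<in> L \<Longrightarrow> v \<in> L \<Longrightarrow> symp u v = 0"
  shows "dim L \<le> CARD('n)"
    and "dim L = CARD('n) \<Longrightarrow> \<forall>l\<in>L. l \<bullet> u = 0 \<Longrightarrow> \<forall>l\<in>L. l \<bullet> v = 0 \<Longrightarrow> symp u v = 0"
proof -
  define J :: "(real ^ 'n) \<times> (real ^ 'n) \<Rightarrow> (real ^ 'n) \<times> (real ^ 'n)" where "J v = (snd v, - fst v)" for v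
  have J: "linear J" "inj J"
    by (auto simp: J_def intro!: linearI injI prod_eqI)
  define K where "K = {y \<in> UNIV. \<forall>x\<in>span L. orthogonal x y}"
  have span_iso: "symp u v = 0" if "u \<in> span L" "v \<in> span L" for u v
    using symp_span[OF that] iso by blast
  have K: "subspace K"
    unfolding K_def by (auto simp: subspace_def orthogonal_def inner_add_right)
  have dimK: "dim K + dim L = 2 * CARD('n)"
    using dim_subspace_orthogonal_to_vectors[of "span L" UNIV] by (simp add: K_def)
  have sub: "J ` span L \<subseteq> K"
    using span_iso by (auto simp: K_def orthogonal_def J_def symp_eq_inner)
  have dimJ: "dim (J ` span L) = dim L"
    using dim_image_eq[OF J(1) inj_on_subset[OF J(2)], of "span L"] by simp
  show "dim L \<le> CARD('n)"
    using dim_subset[OF sub] dimJ dimK by simp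
  assume L: "dim L = CARD('n)" and uv: "\<forall>l\<in>L. l \<bullet> u = 0" "\<forall>l\<in>L. l \<bullet> v = 0"
  have "J ` span L = K"
    using sub K L dimJ dimK by (intro subspace_dim_equal linear_subspace_image J(1)) auto
  moreover have "x \<bullet> y = 0" if "x \<in> span L" "\<forall>l\<in>L. l \<bullet> y = 0" for x y
    using span_induct[OF that(1) subspace_hyperplane2[of y]] that(2) by blast
  then have "u \<in> K" "v \<in> K"
    using uv by (auto simp: K_def orthogonal_def)
  ultimately obtain a b where "a \<in> span L" "b \<in> span L" "u = J a" "v = J b"
    by (metis imageE)
  then show "symp u v = 0"
    using span_iso[of a b] by (simp add: symp_def J_def inner_commute algebra_simps)
qed

text \<open>A row after elimination of the third logarithm of each simplex: the two components are
  the coefficients of the other two logarithms.\<close>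

definition log_form :: "(real ^ 'n) \<times> (real ^ 'n) \<Rightarrow> complex ^ 'n \<Rightarrow> complex" where
  "log_form v w = (\<Sum>i\<in>UNIV. of_real (fst v $ i) * Ln (w $ i) + of_real (snd v $ i) * Ln (1 / (1 - w $ i)))"

text \<open>The logarithm of \<open>1 / (1 - w)\<close> has derivative
  \<open>inverse (1 - w)\<close>; the spelling \<open>1 + (-1) * w\<close> matches the closure rules
  of \<open>ratfun\<close>.\<close>

definition log_form_deriv :: "(real ^ 'n) \<times> (real ^ 'n) \<Rightarrow> 'n \<Rightarrow> complex ^ 'n \<Rightarrow> complex" where
  "log_form_deriv v i w = of_real (fst v $ i) * inverse (w $ i) + of_real (snd v $ i) * inverse (1 + (-1) * w $ i)"

lemma half_space_nonzero:
  assumes "w \<in> half_space"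
  shows "w $ i \<noteq> 0" "1 - w $ i \<noteq> 0" "w $ i \<notin> \<real>\<^sub>\<le>\<^sub>0" "1 - w $ i \<notin> \<real>\<^sub>\<le>\<^sub>0" "1 / (1 - w $ i) \<notin> \<real>\<^sub>\<le>\<^sub>0" "0 < Im (1 / (1 - w $ i))"
proof -
  have im: "0 < Im (w $ i)" using assms by (simp add: half_space_def)
  then show nz: "w $ i \<noteq> 0" "1 - w $ i \<noteq> 0" "w $ i \<notin> \<real>\<^sub>\<le>\<^sub>0" "1 - w $ i \<notin> \<real>\<^sub>\<le>\<^sub>0"
    by (auto simp: complex_eq_iff complex_nonpos_Reals_iff)
  have "Im (1 / (1 - w $ i)) = Im (w $ i) / ((1 - Re (w $ i))\<^sup>2 + (Im (w $ i))\<^sup>2)"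
    by (simp add: Im_divide)
  also have "\<dots> > 0" using im by (intro divide_pos_pos add_nonneg_pos) auto
  finally show "0 < Im (1 / (1 - w $ i))" .
  then show "1 / (1 - w $ i) \<notin> \<real>\<^sub>\<le>\<^sub>0" by (auto simp: complex_nonpos_Reals_iff)
qed

lemma open_half_space: "open (half_space :: (complex ^ 'n::finite) set)"
proof -
  have "half_space = (\<Inter>i. {w :: complex ^ 'n. 0 < Im (w $ i)})" by (auto simp: half_space_def)
  moreover have "open (\<Inter>i. {w :: complex ^ 'n. 0 < Im (w $ i)})"
    by (intro open_INT ballI finite open_Collect_less continuous_intros)
  ultimately show ?thesis by simp
qed

lemma ratfun_log_form_deriv: "ratfun half_space (log_form_deriv v i)"
  unfolding log_form_deriv_def
  using half_space_nonzero by (intro ratfun.intros) auto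

lemma log_form_has_derivative:
  fixes w :: "complex ^ 'n::finite"
  assumes "w \<in> half_space"
  shows "(log_form v has_derivative (\<lambda>h. \<Sum>i\<in>UNIV. log_form_deriv v i w * h $ i)) (at w)"
  unfolding log_form_def
proof (rule has_derivative_sum)
  fix i
  note nz = half_space_nonzero[OF assms, of i]
  have coord: "((\<lambda>w. w $ i) has_derivative (\<lambda>h. h $ i)) (at w)"
    by (rule bounded_linear_imp_has_derivative[OF bounded_linear_vec_nth])
  have "inverse (1 / u) * (1 / u\<^sup>2) = inverse u" if "u \<noteq> 0" for u :: complex
    using that by (simp add: power2_eq_square field_simps)
  moreover have "((\<lambda>z. 1 / (1 - z)) has_field_derivative 1 / (1 - w $ i)\<^sup>2) (at (w $ i))"
    using nz by (auto intro!: derivative_eq_intros simp: power2_eq_square)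
  ultimately have Ln2: "((\<lambda>z. Ln (1 / (1 - z))) has_field_derivative inverse (1 - w $ i)) (at (w $ i))"
    using DERIV_chain2[where f = Ln and g = "\<lambda>z. 1 / (1 - z)" and x = "w $ i", OF has_field_derivative_Ln[OF nz(5)]]
      nz(2) by metis
  have d: "((\<lambda>z. of_real (fst v $ i) * Ln z + of_real (snd v $ i) * Ln (1 / (1 - z)))
      has_field_derivative log_form_deriv v i w) (at (w $ i))"
    using DERIV_add[OF DERIV_cmult[OF has_field_derivative_Ln[OF nz(3)]] DERIV_cmult[OF Ln2]]
    by (simp add: log_form_deriv_def)
  show "((\<lambda>w. of_real (fst v $ i) * Ln (w $ i) + of_real (snd v $ i) * Ln (1 / (1 - w $ i)))
      has_derivative (\<lambda>h. log_form_deriv v i w * h $ i)) (at w)"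
    using has_derivative_compose[OF coord d[unfolded has_field_derivative_def]] by simp
qed

lemma log_form_linear: "linear (\<lambda>v. log_form v w)"
  unfolding log_form_def
  by (rule linearI) (simp_all add: sum.distrib[symmetric] scaleR_sum_right algebra_simps scaleR_conv_of_real[where 'a = complex] sum_distrib_left)

text \<open>With \<open>p = h / w\<close> and \<open>q = h / (1 - w)\<close>, the real and imaginary parts of \<open>(p, q)\<close> are annihilated by
  \<open>L\<close>, and their symplectic product is a sum of positive multiples of \<open>|h|\<^sup>2\<close>.\<close>

lemma log_form_deriv_injective:
  fixes L :: "((real ^ 'n::finite) \<times> (real ^ 'n)) set"
  assumes iso: "\<And>u v. u \<in> L \<Longrightarrow> v \<in> L \<Longrightarrow> symp u v = 0" and "dim L = CARD('n)"
    and w: "w \<in> half_space"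
    and h: "\<And>v. v \<in> L \<Longrightarrow> (\<Sum>i\<in>UNIV. log_form_deriv v i w * h $ i) = 0"
  shows "h = 0"
proof -
  define p where "p i = inverse (w $ i) * h $ i" for i
  define q where "q i = inverse (1 + (-1) * w $ i) * h $ i" for i
  have "(\<Sum>i\<in>UNIV. of_real (fst v $ i) * p i + of_real (snd v $ i) * q i) = 0" if "v \<in> L" for v
    using h[OF that] by (simp add: log_form_deriv_def p_def q_def algebra_simps)
  then have "Re (\<Sum>i\<in>UNIV. of_real (fst v $ i) * p i + of_real (snd v $ i) * q i) = 0"
      "Im (\<Sum>i\<in>UNIV. of_real (fst v $ i) * p i + of_real (snd v $ i) * q i) = 0" if "v \<in> L" for v
    using that by auto
  then have "\<forall>v\<in>L. v \<bullet> (\<chi> i. Re (p i), \<chi> i. Re (q i)) = 0" "\<forall>v\<in>L. v \<bullet> (\<chi> i. Im (p i), \<chi> i. Im (q i)) = 0"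
    by (simp_all add: inner_prod_def inner_vec_def sum.distrib)
  then have "symp (\<chi> i. Re (p i), \<chi> i. Re (q i)) (\<chi> i. Im (p i), \<chi> i. Im (q i)) = 0"
    using isotropic_subspace(2)[OF iso assms(2)] by blast
  \<comment> \<open>\<open>Re p * Im q - Re q * Im p\<close> is the imaginary part of
    \<open>cnj p * q\<close>.\<close>
  then have sum0: "(\<Sum>i\<in>UNIV. Im (cnj (p i) * q i)) = 0"
    by (simp add: symp_def inner_vec_def sum_subtractf algebra_simps)
  \<comment> \<open>Clearing the denominators \<open>cnj w\<close> and \<open>1 - w\<close> leaves a
    nonnegative real factor times \<open>w - w * cnj w\<close>, and \<open>w * cnj w\<close> is
    real.\<close>
  have pos: "Im (cnj (p i) * q i) = Im (w $ i) * (cmod (h $ i))\<^sup>2 / ((cmod (w $ i))\<^sup>2 * (cmod (1 - w $ i))\<^sup>2)" for i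
  proof -
    note nz = half_space_nonzero[OF w, of i]
    have inv: "inverse u = cnj u / of_real ((cmod u)\<^sup>2)" if "u \<noteq> 0" for u :: complex
      unfolding complex_norm_square using that by (simp add: field_simps)
    have "cnj (p i) * q i = (cnj (h $ i) * h $ i) * (inverse (cnj (w $ i)) * inverse (1 - w $ i))"
      by (simp add: p_def q_def)
    also have "cnj (h $ i) * h $ i = of_real ((cmod (h $ i))\<^sup>2)"
      by (metis complex_norm_square mult.commute)
    also have "inverse (cnj (w $ i)) = w $ i / of_real ((cmod (w $ i))\<^sup>2)"
      using inv[of "cnj (w $ i)"] nz(1) by simp
    also have "inverse (1 - w $ i) = (1 - cnj (w $ i)) / of_real ((cmod (1 - w $ i))\<^sup>2)"
      using inv[OF nz(2)] by simp
    also have "of_real ((cmod (h $ i))\<^sup>2) * (w $ i / of_real ((cmod (w $ i))\<^sup>2) *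
        ((1 - cnj (w $ i)) / of_real ((cmod (1 - w $ i))\<^sup>2))) =
        of_real ((cmod (h $ i))\<^sup>2 / ((cmod (w $ i))\<^sup>2 * (cmod (1 - w $ i))\<^sup>2)) * (w $ i - w $ i * cnj (w $ i))"
      by (simp add: field_simps)
    also have "Im \<dots> = (cmod (h $ i))\<^sup>2 / ((cmod (w $ i))\<^sup>2 * (cmod (1 - w $ i))\<^sup>2) * Im (w $ i)"
    proof -
      have "Im (of_real a * z) = a * Im z" for a z by simp
      then show ?thesis by (simp only:) simp
    qed
    finally show ?thesis by simp
  qed
  have im: "0 < Im (w $ i)" for i using w by (simp add: half_space_def)
  have nonneg: "0 \<le> Im (cnj (p i) * q i)" for i
    unfolding pos using im[of i] by simp
  have zero: "Im (cnj (p i) * q i) = 0" for i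
    using sum_nonneg_eq_0_iff[of UNIV "\<lambda>i. Im (cnj (p i) * q i)"] nonneg sum0 by simp
  have "h $ i = 0" for i
    using zero[of i] half_space_nonzero(1,2)[OF w, of i] im[of i] unfolding pos by auto
  then show ?thesis by (simp add: vec_eq_iff)
qed

section \<open>Local coordinates adapted to a level set\<close>

lemma has_derivative_basis_coords:
  fixes \<beta> :: "'n::finite \<Rightarrow> 'v + 'm::finite"
  shows "((\<lambda>y :: complex ^ 'm. \<chi> i. case \<beta> i of Inl b \<Rightarrow> c b | Inr j \<Rightarrow> y $ j - k j) has_derivative
    (\<lambda>d. \<chi> i. case \<beta> i of Inl b \<Rightarrow> 0 | Inr j \<Rightarrow> d $ j)) (at y)"
proof (rule has_derivative_vec_lambda)
  fix i
  have "((\<lambda>y. y $ j - k j) has_derivative (\<lambda>d. d $ j)) (at y)" for j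
    using has_derivative_diff[OF bounded_linear_imp_has_derivative[OF bounded_linear_vec_nth] has_derivative_const]
    by simp
  then show "((\<lambda>y. case \<beta> i of Inl b \<Rightarrow> c b | Inr j \<Rightarrow> y $ j - k j) has_derivative
      (\<lambda>d. case \<beta> i of Inl b \<Rightarrow> 0 | Inr j \<Rightarrow> d $ j)) (at y)"
    by (cases "\<beta> i") simp_all
qed

text \<open>Order 0 is separate because the logarithms are not rational; all higher orders concern
  the rational first derivative.\<close>

lemma C_k_on_log_forms:
  fixes l :: "'m::finite \<Rightarrow> (real ^ 'n::finite) \<times> (real ^ 'n)"
  shows "C_k_on m half_space (\<lambda>w. \<chi> j. if j \<in> I then log_form (l j) w + k j else 0)"
proof (cases m)
  case 0
  have "continuous_on half_space (log_form (l j))" for j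
    using log_form_has_derivative has_derivative_continuous
    by (intro continuous_at_imp_continuous_on) blast
  then have "continuous_on half_space (\<lambda>w. if j \<in> I then log_form (l j) w + k j else 0)" for j
    by (cases "j \<in> I") (auto intro!: continuous_intros)
  then show ?thesis unfolding 0 by (auto intro!: continuous_intros)
next
  case (Suc m')
  let ?H = "\<lambda>w. \<chi> j. if j \<in> I then log_form (l j) w + k j else 0"
  let ?D = "\<lambda>w d. \<chi> j. \<Sum>i\<in>UNIV. of_bool (j \<in> I) * log_form_deriv (l j) i w * d $ i"
  have D: "(?H has_derivative ?D w) (at w)" if "w \<in> half_space" for w
  proof (rule has_derivative_vec_lambda)
    fix j
    show "((\<lambda>w. if j \<in> I then log_form (l j) w + k j else 0) has_derivative
       (\<lambda>d. \<Sum>i\<in>UNIV. of_bool (j \<in> I) * log_form_deriv (l j) i w * d $ i)) (at w)"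
      using has_derivative_add_const[OF log_form_has_derivative[OF that]] by (cases "j \<in> I") simp_all
  qed
  have "C_k_on m' half_space (\<lambda>w. ?D w d)" for d
    by (intro C_k_on_ratfun open_half_space ratfun_sum ratfun.mult ratfun.const ratfun_log_form_deriv)
  moreover have "?D w d = frechet_derivative ?H (at w) d" if "w \<in> half_space" for w d
    by (rule fun_cong[OF frechet_derivative_at[OF D[OF that]]])
  ultimately have "C_k_on m' half_space (\<lambda>w. frechet_derivative ?H (at w) d)" for d
    by (rule C_k_on_cong[OF open_half_space, rotated])
  then show ?thesis
    using D by (auto simp: Suc differentiable_def)
qed

theorem lagrangian_local_diffeomorphism:
  fixes S :: "((real ^ 'n::finite) \<times> (real ^ 'n)) set" and l :: "'m::finite \<Rightarrow> (real ^ 'n) \<times> (real ^ 'n)"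
    and H :: "complex ^ 'n \<Rightarrow> complex ^ 'm"
  assumes iso: "\<And>u v. u \<in> S \<union> l ` I \<Longrightarrow> v \<in> S \<union> l ` I \<Longrightarrow> symp u v = 0"
    and dims: "dim (S \<union> l ` I) = CARD('n)" "dim S + card I = CARD('n)"
    and X: "X = {w \<in> half_space. \<forall>v\<in>S. log_form v w = c v}" "X \<noteq> {}"
    and H: "\<And>w. w \<in> half_space \<Longrightarrow> H w = (\<chi> j. if j \<in> I then log_form (l j) w + k j else 0)"
  shows "local_diffeomorphism_on X (coord_space I) H"
proof -
  obtain B where B: "B \<subseteq> S" "independent B" "S \<subseteq> span B" "card B = dim S"
    by (metis basis_exists)
  have "finite B" using B(2) by (rule finiteI_independent)
  then have "card (UNIV :: 'n set) = card (B <+> I)"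
    using dims(2) B(4) by (simp add: card_Plus)
  moreover have "finite (B <+> I)" using \<open>finite B\<close> by simp
  \<comment> \<open>Indexing by the disjoint sum gives the right number of rows before anything is
    known about repetitions among the \<open>l j\<close> or overlaps with \<open>B\<close>.\<close>
  ultimately obtain \<beta> where \<beta>: "bij_betw \<beta> (UNIV :: 'n set) (B <+> I)"
    using finite_same_card_bij[of "UNIV :: 'n set" "B <+> I"] by auto
  define r where "r i = (case \<beta> i of Inl b \<Rightarrow> b | Inr j \<Rightarrow> l j)" for i
  have \<beta>_in: "\<beta> i \<in> B <+> I" for i using \<beta> by (auto simp: bij_betw_def)
  have \<beta>_surj: "\<exists>i. \<beta> i = x" if "x \<in> B <+> I" for x
    using \<beta> that by (metis bij_betw_imp_surj_on imageE)
  have range_r: "range r = B \<union> l ` I"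
  proof
    show "range r \<subseteq> B \<union> l ` I"
    proof (rule image_subsetI)
      fix i show "r i \<in> B \<union> l ` I" using \<beta>_in[of i] by (auto simp: r_def)
    qed
    have mem: "x \<in> range r" if "case_sum (\<lambda>b. b) l y = x" "y \<in> B <+> I" for x y
    proof -
      obtain i where "\<beta> i = y" using \<beta>_surj[OF \<open>y \<in> B <+> I\<close>] by blast
      then show ?thesis using that(1) by (auto simp: r_def)
    qed
    show "B \<union> l ` I \<subseteq> range r"
    proof
      fix x assume "x \<in> B \<union> l ` I"
      then consider "x \<in> B" | j where "j \<in> I" "x = l j" by blast
      then show "x \<in> range r"
        using mem[of "Inl x" x] mem[of "Inr _" x] by cases auto
    qed
  qed
  have "span (range r) = span (S \<union> l ` I)"
    unfolding range_r
  proof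
    show "span (B \<union> l ` I) \<subseteq> span (S \<union> l ` I)" using B(1) by (intro span_mono) auto
    have "S \<subseteq> span (B \<union> l ` I)" using B(3) span_mono[of B "B \<union> l ` I"] by blast
    then show "span (S \<union> l ` I) \<subseteq> span (B \<union> l ` I)"
      by (intro span_minimal) (auto intro: span_base)
  qed
  then have "dim (range r) = CARD('n)" using dims(1) by (metis dim_span)
  moreover have iso_r: "symp u v = 0" if "u \<in> range r" "v \<in> range r" for u v
    using iso that B(1) unfolding range_r by blast
  ultimately have inj: "h = 0" if "w \<in> half_space" "\<And>j. (\<Sum>i\<in>UNIV. log_form_deriv (r j) i w * h $ i) = 0" for w h
    using log_form_deriv_injective[of "range r" w h] that by blast
  define A where "A w = (\<chi> j i. log_form_deriv (r j) i w)" for w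
  define F where "F w = (\<chi> j. log_form (r j) w)" for w
  have A_rat: "ratfun half_space (\<lambda>w. A w $ i $ j)" for i j
    by (simp add: A_def ratfun_log_form_deriv)
  have F_deriv: "(F has_derivative (*v) (A w)) (at w)" if "w \<in> half_space" for w
  proof -
    have "(*v) (A w) = (\<lambda>h. \<chi> j. \<Sum>i\<in>UNIV. log_form_deriv (r j) i w * h $ i)"
      by (simp add: fun_eq_iff matrix_vector_mult_def A_def)
    then show ?thesis
      unfolding F_def by (simp add: has_derivative_vec_lambda log_form_has_derivative[OF that])
  qed
  have det: "det (A w) \<noteq> 0" if "w \<in> half_space" for w
  proof -
    have "x = 0" if "A w *v x = 0" for x
      using inj[OF \<open>w \<in> half_space\<close>, of x] that by (simp add: vec_eq_iff matrix_vector_mult_def A_def)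
    then have "\<exists>B. B ** A w = mat 1" by (simp add: matrix_left_invertible_ker)
    then show ?thesis by (simp add: invertible_det_nz[symmetric] invertible_left_inverse)
  qed
  \<comment> \<open>The coordinates \<open>F\<close> expressed by the value \<open>y\<close> of
    \<open>H\<close>: those from \<open>B\<close> are frozen at the level, the others are the
    entries of \<open>y\<close> without the additive constants \<open>k\<close>.\<close>
  define aff where "aff y = (\<chi> i. case \<beta> i of Inl b \<Rightarrow> c b | Inr j \<Rightarrow> y $ j - k j)" for y :: "complex ^ 'm"
  have aff_cont: "continuous_on UNIV aff"
    unfolding aff_def
    using has_derivative_continuous[OF has_derivative_basis_coords]
    by (intro continuous_at_imp_continuous_on) blast
  have F_X: "F w = aff (H w)" "H w \<in> coord_space I" if "w \<in> X" for w
  proof -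
    have w: "w \<in> half_space" "\<And>v. v \<in> S \<Longrightarrow> log_form v w = c v" using that X(1) by auto
    have "log_form (r i) w = aff (H w) $ i" for i
      using \<beta>_in[of i] w B(1) by (auto simp: r_def aff_def H[OF w(1)])
    then show "F w = aff (H w)" by (simp add: F_def vec_eq_iff)
    show "H w \<in> coord_space I" by (simp add: H[OF w(1)] coord_space_def)
  qed
  have X_F: "w \<in> X" "H w = y" if w: "w \<in> half_space" and y: "y \<in> coord_space I" and Fy: "F w = aff y" for w y
  proof -
    have ri: "log_form (r i) w = aff y $ i" for i
      using Fy by (simp add: F_def vec_eq_iff)
    \<comment> \<open>The coordinates fix the forms in \<open>B\<close> only. A point of the
      non-empty level set shows that the constants \<open>c\<close> are consistent with the linear
      relations among \<open>S\<close>, so the remaining forms have the right values too.\<close>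
    obtain x where x: "x \<in> half_space" "\<And>v. v \<in> S \<Longrightarrow> log_form v x = c v" using X by auto
    have "log_form b w = log_form b x" if b: "b \<in> B" for b
    proof -
      obtain i where "\<beta> i = Inl b" using \<beta>_surj[OF InlI[OF b]] by blast
      then show ?thesis using ri[of i] x(2)[of b] B(1) b by (auto simp: r_def aff_def)
    qed
    then have "log_form v w = log_form v x" if "v \<in> span B" for v
      using linear_eq_on[OF log_form_linear log_form_linear that] by blast
    then show "w \<in> X" using x B(3) w by (auto simp: X(1))
    have "log_form (l j) w + k j = y $ j" if j: "j \<in> I" for j
    proof -
      obtain i where "\<beta> i = Inr j" using \<beta>_surj[OF InrI[OF j]] by blast
      then show ?thesis using ri[of i] by (auto simp: r_def aff_def)
    qed
    then show "H w = y" using y by (simp add: H[OF w] vec_eq_iff coord_space_def)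
  qed
  show ?thesis
    unfolding local_diffeomorphism_on_def
  proof
    fix w0 assume "w0 \<in> X"
    then have "w0 \<in> half_space" using X by simp
    obtain U V g where UV: "open U" "U \<subseteq> half_space" "w0 \<in> U" "open V" "homeomorphism U V F g"
      and smooth: "\<And>(aff :: complex ^ 'm \<Rightarrow> complex ^ 'n) lin k.
       (\<And>y. (aff has_derivative lin) (at y)) \<Longrightarrow> C_k_on k (aff -` V) (\<lambda>y. g (aff y))"
      using rational_inverse_function[OF open_half_space A_rat F_deriv det \<open>w0 \<in> half_space\<close>] by metis
    have gF: "g (F w) = w" "F w \<in> V" if "w \<in> U" for w
      using UV(5) that by (auto simp: homeomorphism_def)
    have Fg: "F (g z) = z" "g z \<in> U" if "z \<in> V" for z
      using UV(5) that by (auto simp: homeomorphism_def)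
    let ?U = "X \<inter> U"
    have gH: "g (aff (H w)) = w" "aff (H w) \<in> V" if "w \<in> ?U" for w
      using gF[of w] F_X(1)[of w] that by auto
    have Hg: "g (aff y) \<in> ?U" "H (g (aff y)) = y" if "y \<in> coord_space I" "aff y \<in> V" for y
      using X_F[of "g (aff y)" y] Fg[OF that(2)] that(1) UV(2) by auto
    have image: "H ` ?U = coord_space I \<inter> aff -` V"
    proof
      show "H ` ?U \<subseteq> coord_space I \<inter> aff -` V" using gH F_X(2) by auto
      show "coord_space I \<inter> aff -` V \<subseteq> H ` ?U"
        using Hg by (metis IntD1 IntD2 image_eqI subsetI vimageE)
    qed
    have open_aff: "open (aff -` V)" by (rule open_vimage[OF UV(4) aff_cont])
    have injH: "inj_on H ?U" by (rule inj_on_inverseI[of _ "\<lambda>y. g (aff y)"]) (rule gH(1))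
    have "smooth_map_on ?U H"
      unfolding smooth_map_on_def
    proof (intro ballI exI conjI allI)
      fix w assume "w \<in> ?U"
      then show "w \<in> half_space" using UV(2) by blast
      show "C_k_on m half_space (\<lambda>w. \<chi> j. if j \<in> I then log_form (l j) w + k j else 0)" for m
        by (rule C_k_on_log_forms)
      fix w' assume "w' \<in> ?U \<inter> half_space"
      then show "(\<chi> j. if j \<in> I then log_form (l j) w' + k j else 0) = H w'" using H by simp
    qed (rule open_half_space)
    moreover have "smooth_map_on (H ` ?U) (inv_into ?U H)"
      unfolding smooth_map_on_def
    proof
      fix y assume "y \<in> H ` ?U"
      show "\<exists>W G. open W \<and> y \<in> W \<and> (\<forall>k. C_k_on k W G) \<and> (\<forall>y'\<in>H ` ?U \<inter> W. G y' = inv_into ?U H y')"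
      proof (intro exI conjI allI ballI)
        show "open (aff -` V)" by (rule open_aff)
        show "y \<in> aff -` V" using \<open>y \<in> H ` ?U\<close> image by auto
        show "C_k_on k (aff -` V) (\<lambda>y. g (aff y))" for k
          by (rule smooth) (unfold aff_def, rule has_derivative_basis_coords)
        fix y' assume "y' \<in> H ` ?U \<inter> aff -` V"
        then show "g (aff y') = inv_into ?U H y'"
          using gH(1) inv_into_f_f[OF injH] by auto
      qed
    qed
    ultimately have "diffeomorphism_on ?U (H ` ?U) H"
      using injH by (simp add: diffeomorphism_on_def bij_betw_def)
    moreover have "openin (top_of_set X) ?U" using UV(1) by (simp add: openin_open_Int)
    moreover have "openin (top_of_set (coord_space I)) (H ` ?U)"
      unfolding image by (rule openin_open_Int[OF open_aff])
    ultimately show "\<exists>U. w0 \<in> U \<and> openin (top_of_set X) U \<and> openin (top_of_set (coord_space I)) (H ` U) \<and>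
        diffeomorphism_on U (H ` U) H"
      using \<open>w0 \<in> X\<close> UV(3) by blast
  qed
qed

section \<open>Edges and longitudes\<close>

lemma quad_next_simps:
  "quad_next (\<sigma>, quad {L0, L1}) = (\<sigma>, quad {L0, L2})"
  "quad_next (\<sigma>, quad {L0, L2}) = (\<sigma>, quad {L0, L3})"
  "quad_next (\<sigma>, quad {L0, L3}) = (\<sigma>, quad {L0, L1})"
  by (auto simp: quad_next_def quad_explicit doubleton_eq_iff)

text \<open>Coordinates on rows modulo rows constant on each simplex: subtracting the value at the
  third type makes that value zero.\<close>

definition quad_row :: "('t \<Rightarrow> lab set set) \<Rightarrow> ('t \<times> lab set set \<Rightarrow> int) \<Rightarrow> (real ^ 't) \<times> (real ^ 't)" where
  "quad_row pref a =
    (\<chi> \<sigma>. real_of_int (a (\<sigma>, pref \<sigma>) - a (quad_next (quad_next (\<sigma>, pref \<sigma>)))),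
     \<chi> \<sigma>. real_of_int (a (quad_next (\<sigma>, pref \<sigma>)) - a (quad_next (quad_next (\<sigma>, pref \<sigma>)))))"

lemma quad_type_cases:
  assumes "(\<sigma>, Q) \<in> quad_types"
  obtains "Q = quad {L0, L1}" | "Q = quad {L0, L2}" | "Q = quad {L0, L3}"
  using assms unfolding quad_types_eq by blast

text \<open>Rows constant on each simplex pair to zero under \<open>omega\<close>, so it descends to
  the quotient. Its cyclic symmetry makes the result the standard form for every choice of
  \<open>pref\<close>.\<close>

lemma symp_quad_row:
  fixes pref :: "'t::finite \<Rightarrow> lab set set"
  assumes pref: "\<And>\<sigma>. (\<sigma>, pref \<sigma>) \<in> quad_types"
  shows "symp (quad_row pref a) (quad_row pref b) = real_of_int (omega a b)"
proof -
  have "symp (quad_row pref a) (quad_row pref b) = (\<Sum>\<sigma>\<in>UNIV. real_of_int (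
      (a (\<sigma>, pref \<sigma>) - a (quad_next (quad_next (\<sigma>, pref \<sigma>)))) *
      (b (quad_next (\<sigma>, pref \<sigma>)) - b (quad_next (quad_next (\<sigma>, pref \<sigma>)))) -
      (a (quad_next (\<sigma>, pref \<sigma>)) - a (quad_next (quad_next (\<sigma>, pref \<sigma>)))) *
      (b (\<sigma>, pref \<sigma>) - b (quad_next (quad_next (\<sigma>, pref \<sigma>))))))"
    by (simp add: symp_def quad_row_def inner_vec_def sum_subtractf)
  also have "\<dots> = real_of_int (omega a b)"
    unfolding omega_def of_int_sum
  proof (rule sum.cong[OF refl], rule arg_cong[of _ _ real_of_int])
    fix \<sigma>
    show "(a (\<sigma>, pref \<sigma>) - a (quad_next (quad_next (\<sigma>, pref \<sigma>)))) *
      (b (quad_next (\<sigma>, pref \<sigma>)) - b (quad_next (quad_next (\<sigma>, pref \<sigma>)))) -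
      (a (quad_next (\<sigma>, pref \<sigma>)) - a (quad_next (quad_next (\<sigma>, pref \<sigma>)))) *
      (b (\<sigma>, pref \<sigma>) - b (quad_next (quad_next (\<sigma>, pref \<sigma>)))) =
       a (\<sigma>, quad {L0, L1}) * b (\<sigma>, quad {L0, L2}) - a (\<sigma>, quad {L0, L2}) * b (\<sigma>, quad {L0, L1})
     + a (\<sigma>, quad {L0, L2}) * b (\<sigma>, quad {L0, L3}) - a (\<sigma>, quad {L0, L3}) * b (\<sigma>, quad {L0, L2})
     + a (\<sigma>, quad {L0, L3}) * b (\<sigma>, quad {L0, L1}) - a (\<sigma>, quad {L0, L1}) * b (\<sigma>, quad {L0, L3})"
      using pref[of \<sigma>] by (rule quad_type_cases) (simp_all add: quad_next_simps algebra_simps)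
  qed
  finally show ?thesis .
qed

text \<open>As \<open>shapes\<close> is an inverse by choice, the shape equations are available for
  it only at points that \<open>coords\<close> attains.\<close>

lemma coords_surj:
  fixes pref :: "'t::finite \<Rightarrow> lab set set"
  assumes pref: "\<And>\<sigma>. (\<sigma>, pref \<sigma>) \<in> quad_types" and w: "w \<in> half_space"
  shows "w \<in> coords pref ` shape_space"
proof -
  \<comment> \<open>The values \<open>w\<close>, \<open>1 / (1 - w)\<close> and
    \<open>1 - 1 / w\<close> form an orbit of the map taking \<open>z\<close> to
    \<open>1 / (1 - z)\<close>, which has order three.\<close>
  define z where "z = (\<lambda>q\<in>quad_types. if snd q = pref (fst q) then w $ fst q
     else if q = quad_next (fst q, pref (fst q)) then 1 / (1 - w $ fst q) else 1 - 1 / w $ fst q)"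
  have im: "0 < Im (w $ \<sigma>)" "0 < Im (1 / (1 - w $ \<sigma>))" "0 < Im (1 - 1 / w $ \<sigma>)" for \<sigma>
  proof -
    show *: "0 < Im (w $ \<sigma>)" using w by (simp add: half_space_def)
    then have "0 < Im (w $ \<sigma>) / ((Re (w $ \<sigma>))\<^sup>2 + (Im (w $ \<sigma>))\<^sup>2)"
      by (intro divide_pos_pos add_nonneg_pos) auto
    then show "0 < Im (1 - 1 / w $ \<sigma>)" by (simp add: Im_divide)
  qed (rule half_space_nonzero(6)[OF w])
  have nz: "w $ \<sigma> \<noteq> 0" "1 - w $ \<sigma> \<noteq> 0" for \<sigma> by (rule half_space_nonzero[OF w])+
  have z_next: "z (quad_next q) = 1 / (1 - z q)" if "q \<in> quad_types" for q
  proof -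
    obtain \<sigma> Q where q: "q = (\<sigma>, Q)" by fastforce
    have Q: "(\<sigma>, Q) \<in> quad_types" using that by (simp add: q)
    have mem: "(\<sigma>, quad {L0, L1}) \<in> quad_types" "(\<sigma>, quad {L0, L2}) \<in> quad_types" "(\<sigma>, quad {L0, L3}) \<in> quad_types"
      by (simp_all add: quad_types_eq)
    have alg: "1 / (1 - 1 / (1 - w $ \<sigma>)) = 1 - 1 / w $ \<sigma>" "1 / (1 - (1 - 1 / w $ \<sigma>)) = w $ \<sigma>"
      using nz[of \<sigma>] by (simp_all add: field_simps)
    show ?thesis
      by (rule quad_type_cases[OF pref[of \<sigma>]]; rule quad_type_cases[OF Q];
          use alg in \<open>simp add: q z_def mem quad_next_simps quad_distinct\<close>)
  qed
  have "z \<in> quad_types \<rightarrow>\<^sub>E {c. 0 < Im c}"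
    using im by (auto simp: z_def)
  then have "z \<in> shape_space" using z_next by (simp add: shape_space_def)
  moreover have "coords pref z = w"
    using pref by (simp add: coords_def z_def vec_eq_iff)
  ultimately show ?thesis by blast
qed

lemma shapes_eq:
  fixes pref :: "'t::finite \<Rightarrow> lab set set"
  assumes pref: "\<And>\<sigma>. (\<sigma>, pref \<sigma>) \<in> quad_types" and w: "w \<in> half_space"
  shows "shapes pref w (\<sigma>, pref \<sigma>) = w $ \<sigma>"
    "shapes pref w (quad_next (\<sigma>, pref \<sigma>)) = 1 / (1 - w $ \<sigma>)"
    "shapes pref w (quad_next (quad_next (\<sigma>, pref \<sigma>))) = 1 / (1 - 1 / (1 - w $ \<sigma>))"
proof -
  have s: "shapes pref w \<in> shape_space" "coords pref (shapes pref w) = w"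
    using inv_into_into[OF coords_surj[OF assms]] f_inv_into_f[OF coords_surj[OF assms]]
    unfolding shapes_def by auto
  show 1: "shapes pref w (\<sigma>, pref \<sigma>) = w $ \<sigma>"
    using s(2) by (metis coords_def vec_lambda_beta)
  have "quad_next q \<in> quad_types" if "q \<in> quad_types" for q :: "'t \<times> lab set set"
    using that by (auto simp: quad_types_eq quad_next_simps)
  then show 2: "shapes pref w (quad_next (\<sigma>, pref \<sigma>)) = 1 / (1 - w $ \<sigma>)"
    and "shapes pref w (quad_next (quad_next (\<sigma>, pref \<sigma>))) = 1 / (1 - 1 / (1 - w $ \<sigma>))"
    using s(1) pref[of \<sigma>] 1 unfolding shape_space_def by auto
qed

text \<open>The product of the three numbers is -1, so the sum is an odd multiple of i pi. Each
  logarithm has imaginary part between 0 and pi, which leaves only one multiple.\<close>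

lemma Ln_shape_product:
  assumes "0 < Im w"
  shows "Ln w + Ln (1 / (1 - w)) + Ln (1 / (1 - 1 / (1 - w))) = \<i> * pi"
proof -
  let ?a = "1 / (1 - w)" and ?b = "1 / (1 - 1 / (1 - w))"
  have nz: "w \<noteq> 0" "1 - w \<noteq> 0" using assms by (auto simp: complex_eq_iff)
  have b: "?b = 1 - 1 / w" using nz by (simp add: field_simps)
  have "0 < Im w / ((1 - Re w)\<^sup>2 + (Im w)\<^sup>2)" "0 < Im w / ((Re w)\<^sup>2 + (Im w)\<^sup>2)"
    using assms by (auto intro!: divide_pos_pos add_nonneg_pos)
  then have im: "0 < Im ?a" "0 < Im ?b"
    unfolding b by (simp_all add: Im_divide)
  then have nz': "?a \<noteq> 0" "?b \<noteq> 0" by (auto simp: complex_eq_iff simp del: divide_eq_0_iff)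
  have bounds: "0 < Im (Ln w)" "Im (Ln w) < pi" "0 < Im (Ln ?a)" "Im (Ln ?a) < pi" "0 < Im (Ln ?b)" "Im (Ln ?b) < pi"
    using Im_Ln_pos_lt_imp assms im nz nz' Im_Ln_pos_lt by blast+
  have "w * ?a * ?b = -1" unfolding b using nz by (simp add: field_simps)
  then have "exp (Ln w + Ln ?a + Ln ?b) = exp (\<i> * pi)"
    unfolding exp_add exp_Ln[OF nz(1)] exp_Ln[OF nz'(1)] exp_Ln[OF nz'(2)] by simp
  then obtain n :: int where n: "Ln w + Ln ?a + Ln ?b = \<i> * pi + of_int (2 * n) * pi * \<i>"
    unfolding exp_eq by auto
  have im_sum: "Im (Ln w) + Im (Ln ?a) + Im (Ln ?b) = (1 + 2 * real_of_int n) * pi"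
    using arg_cong[OF n, of Im] by (simp add: algebra_simps)
  have "0 < (1 + 2 * real_of_int n) * pi" "(1 + 2 * real_of_int n) * pi < 3 * pi"
    using bounds im_sum by linarith+
  then have "0 < 1 + 2 * real_of_int n" "1 + 2 * real_of_int n < 3"
    using pi_gt_zero by (simp_all only: zero_less_mult_iff mult_less_cancel_right) auto
  then have "n = 0" by linarith
  then show ?thesis using n by simp
qed

lemma sum_Ln_shapes:
  fixes pref :: "'t::finite \<Rightarrow> lab set set"
  assumes pref: "\<And>\<sigma>. (\<sigma>, pref \<sigma>) \<in> quad_types" and w: "w \<in> half_space"
  shows "(\<Sum>q\<in>quad_types. of_int (a q) * Ln (shapes pref w q)) =
    log_form (quad_row pref a) w + (\<Sum>\<sigma>\<in>UNIV. of_int (a (quad_next (quad_next (\<sigma>, pref \<sigma>)))) * (\<i> * pi))"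
  unfolding sum_quad_types log_form_def sum.distrib[symmetric]
proof (rule sum.cong[OF refl])
  fix \<sigma>
  let ?q = "(\<sigma>, pref \<sigma>)" and ?L = "\<lambda>q. of_int (a q) * Ln (shapes pref w q)"
  have "0 < Im (w $ \<sigma>)" using w by (simp add: half_space_def)
  then have third: "Ln (1 / (1 - 1 / (1 - w $ \<sigma>))) = \<i> * pi - Ln (w $ \<sigma>) - Ln (1 / (1 - w $ \<sigma>))"
    using Ln_shape_product[of "w $ \<sigma>"] by (simp add: algebra_simps)
  have "?L (\<sigma>, quad {L0, L1}) + (?L (\<sigma>, quad {L0, L2}) + ?L (\<sigma>, quad {L0, L3})) =
      ?L ?q + ?L (quad_next ?q) + ?L (quad_next (quad_next ?q))"
    using pref[of \<sigma>] by (rule quad_type_cases) (simp_all add: quad_next_simps)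
  also have "\<dots> = of_real (fst (quad_row pref a) $ \<sigma>) * Ln (w $ \<sigma>) + of_real (snd (quad_row pref a) $ \<sigma>) * Ln (1 / (1 - w $ \<sigma>))
      + of_int (a (quad_next (quad_next ?q))) * (\<i> * pi)"
    unfolding shapes_eq[OF assms] third by (simp add: quad_row_def algebra_simps)
  finally show "?L (\<sigma>, quad {L0, L1}) + (?L (\<sigma>, quad {L0, L2}) + ?L (\<sigma>, quad {L0, L3})) = \<dots>" .
qed

section \<open>Rank of the edge rows and independence of the longitudes\<close>

lemma dim_coordinate_subspace:
  "dim {f :: real ^ 'n::finite. \<forall>i. i \<notin> A \<longrightarrow> f $ i = 0} = card A"
proof -
  have "{f :: real ^ 'n. \<forall>i. i \<notin> A \<longrightarrow> f $ i = 0} =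
      {x. \<forall>b\<in>Basis. b \<notin> (\<lambda>i. axis i 1) ` A \<longrightarrow> x \<bullet> b = 0}"
    by (auto simp: Basis_vec_def inner_axis axis_eq_axis)
  moreover have "dim \<dots> = card ((\<lambda>i. axis i (1::real)) ` A)"
    by (rule dim_substandard) (auto simp: Basis_vec_def)
  moreover have "card ((\<lambda>i. axis i (1::real) :: real ^ 'n) ` A) = card A"
    by (rule card_image) (auto simp: inj_on_def axis_eq_axis)
  ultimately show ?thesis by simp
qed

lemma subspace_coordinate: "subspace {f :: real ^ 'n::finite. \<forall>i. i \<notin> A \<longrightarrow> f $ i = 0}"
  by (auto simp: subspace_def)

lemma dim_le_image_kernel:
  fixes f :: "'a::euclidean_space \<Rightarrow> 'b::euclidean_space"
  assumes "linear f" "subspace D"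
  shows "dim D \<le> dim (f ` D) + dim {x \<in> D. f x = 0}"
proof -
  let ?K = "{x \<in> D. f x = 0}"
  let ?C = "{y \<in> D. \<forall>x\<in>?K. orthogonal x y}"
  have K: "subspace ?K"
    using subspace_inter[OF assms(2) linear_subspace_kernel[OF assms(1)]] by (simp add: Collect_conj_eq)
  have "subspace ?C"
    using assms(2) by (auto simp: subspace_def orthogonal_def inner_add_right)
  then have span: "span ?C = ?C" by (simp add: span_eq_iff)
  have "inj_on f ?C"
  proof (rule inj_onI)
    fix x y assume xy: "x \<in> ?C" "y \<in> ?C" "f x = f y"
    have "x - y \<in> ?C" using \<open>subspace ?C\<close> xy(1,2) by (rule subspace_diff)
    moreover have "f (x - y) = 0" using assms(1) xy(3) by (simp add: linear_diff)
    ultimately have "orthogonal (x - y) (x - y)" by blast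
    then show "x = y" by (simp add: orthogonal_def)
  qed
  then have "inj_on f (span ?C)" unfolding span .
  then have "dim (f ` ?C) = dim ?C" by (rule dim_image_eq[OF assms(1)])
  moreover have "dim (f ` ?C) \<le> dim (f ` D)" by (rule dim_subset) blast
  moreover have "dim ?C + dim ?K = dim D"
    by (rule dim_subspace_orthogonal_to_vectors[OF K assms(2)]) blast
  ultimately show ?thesis by simp
qed

text \<open>Pairing with \<open>m j\<close> kills \<open>S\<close> and all other \<open>l k\<close>
  but not \<open>l j\<close>, so each new \<open>l j\<close> raises the dimension by one.\<close>

lemma dim_add_dual_family:
  fixes S :: "((real ^ 'n::finite) \<times> (real ^ 'n)) set"
  assumes "finite I" and S: "\<And>s k. s \<in> S \<Longrightarrow> k \<in> I \<Longrightarrow> symp s (m k) = 0"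
    and lm: "\<And>j k. j \<in> I \<Longrightarrow> k \<in> I \<Longrightarrow> symp (l j) (m k) = 0 \<longleftrightarrow> j \<noteq> k"
  shows "dim (S \<union> l ` I) = dim S + card I"
  using assms
proof (induction I)
  case empty
  then show ?case by simp
next
  case (insert j J)
  have "l j \<notin> span (S \<union> l ` J)"
  proof
    assume "l j \<in> span (S \<union> l ` J)"
    moreover have "symp s (m j) = 0" if "s \<in> S \<union> l ` J" for s
      using that insert.prems insert.hyps(2) by (metis UnE imageE insertI1 insertI2)
    ultimately have "symp (l j) (m j) = 0"
      using symp_span[of "l j" "S \<union> l ` J" "m j" "{m j}"] by (simp add: span_base)
    then show False using insert.prems(2) by simp
  qed
  moreover have "dim (S \<union> l ` J) = dim S + card J"
    using insert.IH insert.prems by simp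
  moreover have "S \<union> l ` insert j J = insert (l j) (S \<union> l ` J)" by auto
  ultimately show ?case using insert.hyps by (simp add: dim_insert)
qed

text \<open>On a triangle with vertices \<open>i\<close>, \<open>j\<close>, \<open>k\<close>, the
  system \<open>g(a) + g(b) = f{a,b}\<close> has a unique solution, and this is its value at
  \<open>i\<close>. The choice of \<open>j\<close> is arbitrary; by \<open>corner_eq\<close> it has
  no effect if the three sums over opposite edges agree.\<close>

definition corner :: "('t \<times> lab set \<Rightarrow> real) \<Rightarrow> 't \<times> lab \<Rightarrow> real" where
  "corner f p = (case p of (\<sigma>, i) \<Rightarrow> let j = (if i = L0 then L1 else L0) in
     (f (\<sigma>, {i, j}) + f (\<sigma>, {i, third i j}) - f (\<sigma>, {j, third i j})) / 2)"

lemma corner_eq: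
  assumes "f (\<sigma>, {L0, L1}) + f (\<sigma>, {L2, L3}) = f (\<sigma>, {L0, L2}) + f (\<sigma>, {L1, L3})"
    and "f (\<sigma>, {L0, L1}) + f (\<sigma>, {L2, L3}) = f (\<sigma>, {L0, L3}) + f (\<sigma>, {L1, L2})"
    and "i \<noteq> j"
  shows "corner f (\<sigma>, i) = (f (\<sigma>, {i, j}) + f (\<sigma>, {i, third i j}) - f (\<sigma>, {j, third i j})) / 2"
    and "corner f (\<sigma>, i) + corner f (\<sigma>, j) = f (\<sigma>, {i, j})"
  using assms
  by (cases i; cases j; simp add: corner_def insert_commute field_simps)+

text \<open>The corner value can be computed in any face containing the vertex, in particular in the
  glued one, whose edges carry the same weights on both sides.\<close>

lemma corner_invariant:
  assumes T: "singular_triangulation gl" and inv: "edge_invariant gl f"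
    and eq: "\<And>\<sigma>. f (\<sigma>, {L0, L1}) + f (\<sigma>, {L2, L3}) = f (\<sigma>, {L0, L2}) + f (\<sigma>, {L1, L3})"
      "\<And>\<sigma>. f (\<sigma>, {L0, L1}) + f (\<sigma>, {L2, L3}) = f (\<sigma>, {L0, L3}) + f (\<sigma>, {L1, L2})"
    and "(p, p') \<in> (vertex_rel gl)\<^sup>*"
  shows "corner f p' = corner f p"
  using assms(5)
proof induction
  case (step y z)
  then obtain \<sigma> i j where yz: "y = (\<sigma>, j)" "z = (nbr gl \<sigma> i, gmap gl \<sigma> i j)" "j \<noteq> i"
    by blast
  let ?p = "gmap gl \<sigma> i" and ?k = "third j i" and ?l = "fourth j i"
  note ne = yz(3) third_neq[OF yz(3)]
  have f: "f (nbr gl \<sigma> i, {?p a, ?p b}) = f (\<sigma>, {a, b})" if "a \<noteq> b" "a \<noteq> i" "b \<noteq> i" for a b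
    using inv[unfolded edge_invariant_def, rule_format, of "{a, b}" i \<sigma>] that by simp
  \<comment> \<open>The gluing is odd, so \<open>third\<close> reaches the image of
    \<open>?k\<close> when started from that of \<open>?l\<close>.\<close>
  have pl: "third (?p j) (?p ?l) = ?p ?k"
    using gmap_fourth[OF T, of j ?l \<sigma> i] ne by (simp add: third_fourth)
  have "corner f z = (f (nbr gl \<sigma> i, {?p j, ?p ?l}) + f (nbr gl \<sigma> i, {?p j, ?p ?k}) - f (nbr gl \<sigma> i, {?p ?l, ?p ?k})) / 2"
    unfolding yz(2) using corner_eq(1)[of f "nbr gl \<sigma> i" "?p j" "?p ?l"] eq ne
    by (simp add: pl gmap_eq_iff[OF T])
  also have "\<dots> = (f (\<sigma>, {j, ?k}) + f (\<sigma>, {j, ?l}) - f (\<sigma>, {?k, ?l})) / 2"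
    using ne by (simp add: f insert_commute)
  also have "\<dots> = corner f y"
    unfolding yz(1) using corner_eq(1)[of f \<sigma> j ?k] eq ne by simp
  finally show ?case using step.IH by simp
qed simp

text \<open>Rank and nullity for \<open>\<Lambda>\<close>, which sends weights on edges to
  combinations of rows. A combination vanishes modulo constants iff the sums over opposite edges
  agree in each simplex; such weights come from weights on vertices through \<open>corner\<close>,
  so the kernel has dimension at most \<open>|V|\<close>.\<close>

lemma dim_edge_rows:
  fixes gl :: "('t::finite) gluing" and pref :: "'t \<Rightarrow> lab set set"
  assumes T: "singular_triangulation gl" and pref: "\<And>\<sigma>. (\<sigma>, pref \<sigma>) \<in> quad_types"
  shows "card (edges gl) \<le> dim ((\<lambda>e. quad_row pref (\<lambda>q. int (quad_index q e))) ` edges gl) + card (vertices gl)"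
proof -
  let ?row = "\<lambda>e. quad_row pref (\<lambda>q. int (quad_index q e))"
  define \<Lambda> where "\<Lambda> f = (\<Sum>e\<in>edges gl. f $ e *\<^sub>R ?row e)" for f :: "real ^ ('t \<times> lab set) set"
  define D where "D = {f :: real ^ ('t \<times> lab set) set. \<forall>e. e \<notin> edges gl \<longrightarrow> f $ e = 0}"
  define DV where "DV = {f :: real ^ ('t \<times> lab) set. \<forall>v. v \<notin> vertices gl \<longrightarrow> f $ v = 0}"
  define rep where "rep e = (SOME y. y \<in> e)" for e :: "('t \<times> lab set) set"
  \<comment> \<open>The sum runs over the two labels of a representative, so an edge with both ends
    at one vertex counts that vertex twice.\<close>
  define \<Gamma> where "\<Gamma> g = (\<chi> e. if e \<in> edges gl
      then \<Sum>i\<in>snd (rep e). g $ vertex_class gl (fst (rep e), i) else 0)" for g :: "real ^ ('t \<times> lab) set"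
  have lin: "linear \<Lambda>"
    unfolding \<Lambda>_def
    by (rule linearI) (simp_all add: scaleR_add_left sum.distrib scaleR_sum_right)
  have lin\<Gamma>: "linear \<Gamma>"
    unfolding \<Gamma>_def
    by (rule linearI) (simp_all add: vec_eq_iff sum.distrib sum_distrib_left)
  have kernel: "{f \<in> D. \<Lambda> f = 0} \<subseteq> \<Gamma> ` DV"
  proof
    fix f assume "f \<in> {f \<in> D. \<Lambda> f = 0}"
    then have D: "f \<in> D" and \<Lambda>: "\<Lambda> f = 0" by auto
    define fh where "fh y = f $ edge_class gl y" for y
    define a where "a q = (\<Sum>x\<in>snd q. fh (fst q, x))" for q
    have a: "a q = (\<Sum>e\<in>edges gl. f $ e * real (quad_index q e))" if "q \<in> quad_types" for q
    proof -
      have qi: "real (quad_index q e) = (\<Sum>x\<in>snd q. of_bool ((fst q, x) \<in> e))" for e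
        using quad_index_eq[of q e] unfolding edge_row_def
        by (metis (mono_tags, lifting) of_int_of_bool of_int_of_nat_eq of_int_sum sum.cong)
      have "(\<Sum>e\<in>edges gl. f $ e * real (quad_index q e)) =
          (\<Sum>x\<in>snd q. \<Sum>e\<in>edges gl. f $ e * of_bool ((fst q, x) \<in> e))"
        unfolding qi sum_distrib_left by (rule sum.swap)
      also have "\<dots> = (\<Sum>x\<in>snd q. fh (fst q, x))"
      proof (rule sum.cong[OF refl])
        fix x assume "x \<in> snd q"
        then have "card x = 2"
          using that by (auto simp: quad_types_eq quad_explicit)
        then have "edge_class gl (fst q, x) \<in> edges gl" by (rule edge_class_in)
        moreover have "(fst q, x) \<in> e \<longleftrightarrow> e = edge_class gl (fst q, x)" if "e \<in> edges gl" for e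
          using edge_class_eq[OF T that] edge_class_self by metis
        ultimately show "(\<Sum>e\<in>edges gl. f $ e * of_bool ((fst q, x) \<in> e)) = fh (fst q, x)"
          by (simp add: fh_def of_bool_def mult_delta_right sum.delta cong: sum.cong)
      qed
      finally show ?thesis by (simp add: a_def)
    qed
    have a_eq: "a (\<sigma>, pref \<sigma>) = a (quad_next (quad_next (\<sigma>, pref \<sigma>)))"
      "a (quad_next (\<sigma>, pref \<sigma>)) = a (quad_next (quad_next (\<sigma>, pref \<sigma>)))" for \<sigma>
    proof -
      have mem: "quad_next (\<sigma>, pref \<sigma>) \<in> quad_types" "quad_next (quad_next (\<sigma>, pref \<sigma>)) \<in> quad_types"
        using pref[of \<sigma>] by (auto simp: quad_types_eq quad_next_simps)
      have "fst (\<Lambda> f) $ \<sigma> = 0" "snd (\<Lambda> f) $ \<sigma> = 0" by (simp_all add: \<Lambda>)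
      then show "a (\<sigma>, pref \<sigma>) = a (quad_next (quad_next (\<sigma>, pref \<sigma>)))"
        "a (quad_next (\<sigma>, pref \<sigma>)) = a (quad_next (quad_next (\<sigma>, pref \<sigma>)))"
        unfolding a[OF pref] a[OF mem(1)] a[OF mem(2)]
        by (simp_all add: \<Lambda>_def quad_row_def fst_sum snd_sum algebra_simps sum_subtractf)
    qed
    have eq: "fh (\<sigma>, {L0, L1}) + fh (\<sigma>, {L2, L3}) = fh (\<sigma>, {L0, L2}) + fh (\<sigma>, {L1, L3})"
       "fh (\<sigma>, {L0, L1}) + fh (\<sigma>, {L2, L3}) = fh (\<sigma>, {L0, L3}) + fh (\<sigma>, {L1, L2})" for \<sigma>
    proof -
      have "a (\<sigma>, quad {L0, L1}) = a (\<sigma>, quad {L0, L2})" "a (\<sigma>, quad {L0, L1}) = a (\<sigma>, quad {L0, L3})"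
        using pref[of \<sigma>] a_eq[of \<sigma>] by (auto elim!: quad_type_cases simp: quad_next_simps)
      then show "fh (\<sigma>, {L0, L1}) + fh (\<sigma>, {L2, L3}) = fh (\<sigma>, {L0, L2}) + fh (\<sigma>, {L1, L3})"
       "fh (\<sigma>, {L0, L1}) + fh (\<sigma>, {L2, L3}) = fh (\<sigma>, {L0, L3}) + fh (\<sigma>, {L1, L2})"
        by (simp_all add: a_def quad_explicit doubleton_eq_iff)
    qed
    have inv: "edge_invariant gl fh" unfolding fh_def by (rule edge_invariant_edge_class[OF T])
    define g where "g = (\<chi> v. if v \<in> vertices gl then corner fh (SOME p. p \<in> v) else 0)"
    have g: "g $ vertex_class gl p = corner fh p" for p
    proof -
      have "(SOME p'. p' \<in> vertex_class gl p) \<in> vertex_class gl p"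
        by (rule someI[of _ p]) (rule vertex_class_self)
      then have "(p, SOME p'. p' \<in> vertex_class gl p) \<in> (vertex_rel gl)\<^sup>*"
        by (simp add: vertex_class_def)
      then show ?thesis
        using corner_invariant[OF T inv eq] by (simp add: g_def vertex_class_in)
    qed
    have "\<Gamma> g = f"
      unfolding vec_eq_iff
    proof
      fix e
      show "\<Gamma> g $ e = f $ e"
      proof (cases "e \<in> edges gl")
        case False
        then show ?thesis using D by (simp add: \<Gamma>_def D_def)
      next
        case True
        obtain \<sigma> x where r: "rep e = (\<sigma>, x)" by fastforce
        obtain y where "y \<in> e" using True unfolding edges_def by (auto elim!: quotientE)
        then have "rep e \<in> e" unfolding rep_def by (rule someI)
        then have e: "edge_class gl (\<sigma>, x) = e" "card x = 2"
          using edge_class_eq[OF T True] edge_card[OF T True] r by auto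
        obtain i j where ij: "i \<noteq> j" "x = {i, j}" using e(2) by (rule card_2_labE)
        have "\<Gamma> g $ e = corner fh (\<sigma>, i) + corner fh (\<sigma>, j)"
          using True ij by (simp add: \<Gamma>_def r g)
        also have "\<dots> = fh (\<sigma>, {i, j})" using corner_eq(2)[OF eq ij(1)] .
        finally show ?thesis by (simp add: fh_def e(1) ij(2)[symmetric])
      qed
    qed
    moreover have "g \<in> DV" by (simp add: DV_def g_def)
    ultimately show "f \<in> \<Gamma> ` DV" by blast
  qed
  have "card (edges gl) = dim D" unfolding D_def by (rule dim_coordinate_subspace[symmetric])
  also have "\<dots> \<le> dim (\<Lambda> ` D) + dim {f \<in> D. \<Lambda> f = 0}"
    by (rule dim_le_image_kernel[OF lin]) (simp add: D_def subspace_coordinate)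
  also have "dim (\<Lambda> ` D) \<le> dim (?row ` edges gl)"
  proof -
    have "\<Lambda> ` D \<subseteq> span (?row ` edges gl)"
    proof (rule image_subsetI)
      fix f show "\<Lambda> f \<in> span (?row ` edges gl)"
        unfolding \<Lambda>_def by (intro span_sum span_scale span_base imageI)
    qed
    then show ?thesis by (metis dim_span dim_subset)
  qed
  also have "dim {f \<in> D. \<Lambda> f = 0} \<le> dim (\<Gamma> ` DV)" by (rule dim_subset[OF kernel])
  also have "\<dots> \<le> dim DV" by (rule dim_image_le[OF lin\<Gamma>])
  also have "dim DV = card (vertices gl)" unfolding DV_def by (rule dim_coordinate_subspace)
  finally show ?thesis by simp
qed

section \<open>The Lagrangian subspace of edges and longitudes\<close>

lemma intersection_number_distinct_links:
  assumes "singular_triangulation gl" "v \<in> vertices gl" "v' \<in> vertices gl" "v \<noteq> v'"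
    and "closed_normal_curve gl v \<alpha>" "closed_normal_curve gl v' \<beta>"
  shows "intersection_number \<alpha> \<beta> = 0"
proof -
  have "seg_intersection s s' = 0" if s: "s \<in> set \<alpha>" "s' \<in> set \<beta>" for s s'
  proof -
    obtain \<sigma> i a b where 1: "s = (\<sigma>, i, a, b)" by (metis prod_cases4)
    obtain \<tau> i' a' b' where 2: "s' = (\<tau>, i', a', b')" by (metis prod_cases4)
    have "(\<sigma>, i) \<in> v" "(\<tau>, i') \<in> v'"
      using assms(5,6) s unfolding closed_normal_curve_def 1 2 by blast+
    then have "(\<sigma>, i) \<noteq> (\<tau>, i')"
      using vertices_disjoint[OF assms(1-3)] assms(4) by metis
    then show ?thesis
      unfolding 1 2 seg_intersection.simps seg_entry.simps triangle_of.simps by (rule if_not_P)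
  qed
  then show ?thesis
    unfolding intersection_number_def by (simp cong: map_cong)
qed

theorem corollary10:
  fixes gl :: "('t::finite) gluing"
    and pref :: "'t \<Rightarrow> lab set set"
    and I :: "('l::finite) set"
    and vtx :: "'l \<Rightarrow> ('t \<times> lab) set"
    and lon mer :: "'l \<Rightarrow> 't curve"
    and u :: "('t \<times> lab set) set \<Rightarrow> complex"
  assumes "singular_triangulation gl"
    and "\<And>\<sigma>. (\<sigma>, pref \<sigma>) \<in> quad_types"
    and "canonical_curve_system gl I vtx lon mer"
    and "u \<in> edges gl \<rightarrow>\<^sub>E UNIV"
    and "level_set gl pref u \<noteq> {}"
  shows "local_diffeomorphism_on (level_set gl pref u) (coord_space I)
           (\<lambda>w. boundary_map I lon (shapes pref w))"
proof -
  note T = assms(1) and pref = assms(2)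
  define row where "row = quad_row pref"
  define er where "er e = row (\<lambda>q. int (quad_index q e))" for e
  define l where "l j = row (\<lambda>q. curve_eta q (lon j))" for j
  define m where "m j = row (\<lambda>q. curve_eta q (mer j))" for j
  define S where "S = er ` edges gl"
  \<comment> \<open>The additive constant left by eliminating the third logarithm of every
    simplex.\<close>
  define K where "K a = (\<Sum>\<sigma>\<in>UNIV. of_int (a (quad_next (quad_next (\<sigma>, pref \<sigma>)))) * (\<i> * pi))" for a :: "'t \<times> lab set set \<Rightarrow> int"
  have symp_row: "symp (row a) (row b) = real_of_int (omega a b)" for a b
    unfolding row_def by (rule symp_quad_row[OF pref])
  have curves: "closed_normal_curve gl (vtx j) (lon j)" "closed_normal_curve gl (vtx j) (mer j)" if "j \<in> I" for j
    using assms(3) that unfolding canonical_curve_system_def canonical_generators_def by blast+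
  have er_er: "symp (er e) (er e') = 0" if "e \<in> edges gl" "e' \<in> edges gl" for e e'
    unfolding er_def symp_row quad_index_eq
    using omega_edge_edge[OF T edge_invariant_mem[OF T that(1)] edge_invariant_mem[OF T that(2)]] by simp
  have er_curve: "symp (er e) (row (\<lambda>q. curve_eta q \<alpha>)) = 0" if "e \<in> edges gl" "closed_normal_curve gl v \<alpha>" for e v \<alpha>
    unfolding er_def symp_row quad_index_eq
    using omega_edge_curve[OF T edge_invariant_mem[OF T that(1)] that(2)] by simp
  have same: "vtx j = vtx k \<Longrightarrow> intersection_number (lon j) (lon k) = 0"
      "vtx j = vtx k \<Longrightarrow> intersection_number (lon j) (mer k) = of_bool (j = k)"
    if "j \<in> I" "k \<in> I" for j k
  proof -
    have "canonical_generators gl (vtx k) {i \<in> I. vtx i = vtx k} lon mer"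
      using assms(3) that unfolding canonical_curve_system_def by blast
    then show "vtx j = vtx k \<Longrightarrow> intersection_number (lon j) (lon k) = 0"
      "vtx j = vtx k \<Longrightarrow> intersection_number (lon j) (mer k) = of_bool (j = k)"
      using that unfolding canonical_generators_def by auto
  qed
  have other: "vtx j \<noteq> vtx k \<Longrightarrow> intersection_number (lon j) (lon k) = 0"
      "vtx j \<noteq> vtx k \<Longrightarrow> intersection_number (lon j) (mer k) = 0"
    if "j \<in> I" "k \<in> I" for j k
  proof -
    have "vtx j \<in> vertices gl" "vtx k \<in> vertices gl"
      using assms(3) that unfolding canonical_curve_system_def by auto
    note disjoint = intersection_number_distinct_links[OF T this _ curves(1)[OF that(1)]]
    show "vtx j \<noteq> vtx k \<Longrightarrow> intersection_number (lon j) (lon k) = 0"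
      by (rule disjoint[OF _ curves(1)[OF that(2)]])
    show "vtx j \<noteq> vtx k \<Longrightarrow> intersection_number (lon j) (mer k) = 0"
      by (rule disjoint[OF _ curves(2)[OF that(2)]])
  qed
  have l_curve: "symp (l j) (row (\<lambda>q. curve_eta q \<alpha>)) = 2 * of_int (intersection_number (lon j) \<alpha>)"
    if "j \<in> I" "closed_normal_curve gl v \<alpha>" for j v \<alpha>
    unfolding l_def symp_row using omega_curve_curve[OF T curves(1)[OF that(1)] that(2)] by simp
  have l_l: "symp (l j) (l k) = 0" if jk: "j \<in> I" "k \<in> I" for j k
    using l_curve[OF jk(1) curves(1)[OF jk(2)]] same(1)[OF jk] other(1)[OF jk]
    unfolding l_def[of k] by (cases "vtx j = vtx k") auto
  have l_m: "symp (l j) (m k) = 0 \<longleftrightarrow> j \<noteq> k" if jk: "j \<in> I" "k \<in> I" for j k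
    using l_curve[OF jk(1) curves(2)[OF jk(2)]] same(2)[OF jk] other(2)[OF jk]
    unfolding m_def[of k] by (cases "vtx j = vtx k") auto
  have iso: "symp v v' = 0" if "v \<in> S \<union> l ` I" "v' \<in> S \<union> l ` I" for v v'
    using that er_er l_l er_curve[OF _ curves(1), folded l_def] symp_swap
    unfolding S_def by (metis (no_types, lifting) UnE imageE neg_equal_0_iff_equal)
  have dim_sum: "dim (S \<union> l ` I) = dim S + card I"
  proof (rule dim_add_dual_family[where m = m])
    show "symp s (m k) = 0" if "s \<in> S" "k \<in> I" for s k
      using that er_curve[OF _ curves(2)] unfolding S_def m_def by blast
  qed (simp_all add: l_m)
  \<comment> \<open>The rank bound \<open>|E| - |V|\<close> and the count of simplices combine to
    this lower bound; isotropy supplies the matching upper one.\<close>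
  have "CARD('t) \<le> dim S + card I"
    using dim_edge_rows[OF T pref] count_simplices[OF T assms(3)]
    unfolding S_def er_def row_def by simp
  moreover have "dim (S \<union> l ` I) \<le> CARD('t)" by (rule isotropic_subspace(1)) (rule iso)
  ultimately have dims: "dim (S \<union> l ` I) = CARD('t)" "dim S + card I = CARD('t)"
    using dim_sum by simp_all
  have log_curv: "log_curvature gl (shapes pref w) e = log_form (er e) w + K (\<lambda>q. int (quad_index q e))"
    if "w \<in> half_space" "e \<in> edges gl" for w e
    using sum_Ln_shapes[OF pref that(1), of "\<lambda>q. int (quad_index q e)"] that(2)
    by (simp add: log_curvature_def er_def row_def K_def)
  obtain w0 where w0: "w0 \<in> half_space" "log_curvature gl (shapes pref w0) = u"
    using assms(5) by (auto simp: level_set_def)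
  \<comment> \<open>Comparing with a point of the level set cancels the constants \<open>K\<close>,
    so the curvature equations become conditions on the forms alone.\<close>
  define c where "c v = log_form v w0" for v
  have level: "level_set gl pref u = {w \<in> half_space. \<forall>v\<in>S. log_form v w = c v}"
  proof -
    have "log_curvature gl (shapes pref w) = u \<longleftrightarrow> (\<forall>v\<in>S. log_form v w = c v)" if "w \<in> half_space" for w
    proof -
      have "log_curvature gl (shapes pref w) = u \<longleftrightarrow>
          (\<forall>e\<in>edges gl. log_curvature gl (shapes pref w) e = log_curvature gl (shapes pref w0) e)"
        unfolding w0(2)[symmetric] by (auto simp: fun_eq_iff log_curvature_def)
      also have "\<dots> \<longleftrightarrow> (\<forall>e\<in>edges gl. log_form (er e) w = c (er e))"
        using log_curv[OF that] log_curv[OF w0(1)] by (simp add: c_def)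
      finally show ?thesis by (simp add: S_def)
    qed
    then show ?thesis by (auto simp: level_set_def)
  qed
  show ?thesis
  proof (rule lagrangian_local_diffeomorphism[OF iso dims level assms(5)])
    fix w :: "complex ^ 't" assume "w \<in> half_space"
    then have "log_holonomy (lon j) (shapes pref w) = log_form (l j) w + K (\<lambda>q. curve_eta q (lon j))" for j
      unfolding log_holonomy_def l_def row_def K_def by (rule sum_Ln_shapes[OF pref])
    then show "boundary_map I lon (shapes pref w) =
        (\<chi> j. if j \<in> I then log_form (l j) w + K (\<lambda>q. curve_eta q (lon j)) else 0)"
      by (simp add: boundary_map_def vec_eq_iff)
  qed
qed

end
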